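(* Let $(M,\omega)$ be a compact quantizable Kähler manifold with quantum line bundle $(L,h,\nabla)$, where $L$ is very ample. Then the Toeplitz map $C^\infty(M)\to\mathrm{End}(\Gamma_{hol}(M,L))$, $f\mapsto T_f$, and the covariant symbol map $\mathrm{End}(\Gamma_{hol}(M,L))\to C^\infty(M)$, $A\mapsto\sigma(A)$, are adjoint: for all $A\in\mathrm{End}(\Gamma_{hol}(M,L))$ and all $f\in C^\infty(M)$, $$\langle A,T_f\rangle_{HS}=\langle\sigma(A),f\rangle_{\epsilon},$$ where $\langle A,C\rangle_{HS}=\mathrm{Tr}(A^*C)$ and $\langle g,f\rangle_\epsilon=\int_M\overline{g(x)}\,f(x)\,\Omega_\epsilon(x)$.
   Context: Setting. $(M,\omega)$ is a compact Kähler manifold of complex dimension $n$ with Kähler form $\omega$. A quantum line bundle $(L,h,\nabla)$ for it consists of a holomorphic line bundle $L$ over $M$, a hermitian metric $h$ on $L$ (conjugate linear in the first argument), and the unique connection $\nabla$ on $L$ compatible with the complex structure and the metric, such that its curvature satisfies $F(X,Y)=\nabla_X\nabla_Y-\nabla_Y\nabla_X-\nabla_{[X,Y]}=-\mathrm{i}\,\omega(X,Y)$ for all vector fields $X,Y$. $(M,\omega)$ is called quantizable if such a bundle exists. It is assumed that $L$ is very ample. Scalar product and Toeplitz operators. $\Omega=\frac1{n!}\omega^{\wedge n}$ is the volume form on $M$. The space $\Gamma_\infty(M,L)$ of smooth global sections carries the scalar product $\langle\varphi,\psi\rangle=\int_M h(\varphi,\psi)\,\Omega$, with $\mathrm{L}^2$-completion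 $\mathrm{L}^2(M,L)$. $\Gamma_{hol}(M,L)$ is the finite-dimensional subspace of global holomorphic sections, with the induced scalar product, and $\Pi:\mathrm{L}^2(M,L)\to\Gamma_{hol}(M,L)$ is the orthogonal projection. $C^\infty(M)$ is the space of complex-valued smooth functions. For $f\in C^\infty(M)$ the Toeplitz operator is $T_f:\Gamma_{hol}(M,L)\to\Gamma_{hol}(M,L)$, $T_f s=\Pi(f\cdot s)$. $A^*$ denotes the adjoint of $A$ with respect to the scalar product on $\Gamma_{hol}(M,L)$. Coherent vectors. Let $\pi:L\to M$ be the bundle projection and $L_0$ the total space of $L$ with the zero section removed. For $q\in L_0$ and $s\in\Gamma_{hol}(M,L)$ define $\hat q(s)\in\mathbb{C}$ by $s(\pi(q))=\hat q(s)\,q$. The coherent vector $e_q\in\Gamma_{hol}(M,L)$ is the unique holomorphic section with $\langle e_q,s\rangle=\hat q(s)$ for all $s\in\Gamma_{hol}(M,L)$; it is nonzero since $L$ is very ample, and $e_{cq}=\bar c^{-1}e_q$ for $c\in\mathbb{C}^*$. For $x\in M$ choose $q\in L_0$ with $\pi(q)=x$; the following do not depend on the choice of $q$: the coherent projector $P_x=\frac{|e_q\rangle\langle e_q|}{\langle e_q,e_q\rangle}$ (orthogonal projection of $\Gamma_{hol}(M,L)$ onto $\mathbb{C}e_q$), and Rawnsley's epsilon function $\epsilon(x)=|q|^2\langle e_q,e_q\rangle>0$, where $|q|^2=h(x)(q,q)$. The modified measure is $\Omega_\epsilon(x)=\epsilon(x)\,\Omega(x)$. Covariant symbol. For $A\in\mathrm{End}(\Gamma_{hol}(M,L))$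 the covariant Berezin symbol $\sigma(A)\in C^\infty(M)$ is $\sigma(A)(x)=\mathrm{Tr}(AP_x)=\frac{\langle e_q,Ae_q\rangle}{\langle e_q,e_q\rangle}$, $q\in\pi^{-1}(x)$, $q\neq0$. *)

theory Defs
  imports "HOL-Analysis.Analysis" "HOL-Library.Function_Algebras"
begin

section \<open>Calculus on open subsets of \<open>\<complex>\<^sup>n\<close>\<close>

primrec Ck_on :: "nat \<Rightarrow> 'a::real_normed_vector set \<Rightarrow> ('a \<Rightarrow> 'b::real_normed_vector) \<Rightarrow> bool" where
  "Ck_on 0 S f \<longleftrightarrow> continuous_on S f"
| "Ck_on (Suc k) S f \<longleftrightarrow>
     (\<forall>x\<in>S. f differentiable (at x)) \<and> (\<forall>v. Ck_on k S (\<lambda>x. frechet_derivative f (at x) v))"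

definition smooth_on :: "'a::real_normed_vector set \<Rightarrow> ('a \<Rightarrow> 'b::real_normed_vector) \<Rightarrow> bool" where
  "smooth_on S f \<longleftrightarrow> (\<forall>k. Ck_on k S f)"

definition hol_on :: "(complex^'n) set \<Rightarrow> (complex^'n \<Rightarrow> complex) \<Rightarrow> bool" where
  "hol_on S f \<longleftrightarrow>
     (\<forall>z\<in>S. \<exists>f'. (f has_derivative f') (at z) \<and> (\<forall>c v. f' (c *s v) = c * f' v))"


section \<open>Complex manifolds\<close>

text \<open>The manifold is the whole type \<open>'m\<close>, a Hausdorff space; its complex dimension is
  \<open>CARD('n)\<close>. A chart is a pair of an open domain and a coordinate map. (A compact space covered
  by charts is second countable, so this is not listed.)\<close>

type_synonym ('m, 'n) chart = "'m set \<times> ('m \<Rightarrow> complex^'n)"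

text \<open>The expression in the chart \<open>c\<close> of a function on the manifold.\<close>

definition local_expr :: "('m, 'n) chart \<Rightarrow> ('m \<Rightarrow> 'b) \<Rightarrow> complex^'n \<Rightarrow> 'b" where
  "local_expr c f = f \<circ> the_inv_into (fst c) (snd c)"

definition complex_atlas :: "('m::t2_space, 'n::finite) chart set \<Rightarrow> bool" where
  "complex_atlas \<A> \<longleftrightarrow>
     (\<Union>c\<in>\<A>. fst c) = UNIV \<and>
     (\<forall>c\<in>\<A>. open (fst c) \<and> open (snd c ` fst c) \<and>
        homeomorphism (fst c) (snd c ` fst c) (snd c) (the_inv_into (fst c) (snd c))) \<and>
     (\<forall>c\<in>\<A>. \<forall>d\<in>\<A>. \<forall>i. hol_on (snd c ` (fst c \<inter> fst d)) (local_expr c (\<lambda>x. snd d x $ i)))"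

definition smooth_fun_on ::
  "('m, 'n::finite) chart set \<Rightarrow> 'm set \<Rightarrow> ('m \<Rightarrow> 'b::real_normed_vector) \<Rightarrow> bool" where
  "smooth_fun_on \<A> W f \<longleftrightarrow> (\<forall>c\<in>\<A>. smooth_on (snd c ` (W \<inter> fst c)) (local_expr c f))"

definition hol_fun_on :: "('m, 'n::finite) chart set \<Rightarrow> 'm set \<Rightarrow> ('m \<Rightarrow> complex) \<Rightarrow> bool" where
  "hol_fun_on \<A> W f \<longleftrightarrow> (\<forall>c\<in>\<A>. hol_on (snd c ` (W \<inter> fst c)) (local_expr c f))"

text \<open>The differential at \<open>x\<close> of a function, in the chart \<open>c\<close>, applied to a coordinate vector.\<close>

definition diff_at ::
  "('m, 'n::finite) chart \<Rightarrow> 'm \<Rightarrow> ('m \<Rightarrow> 'b::real_normed_vector) \<Rightarrow> complex^'n \<Rightarrow> 'b" where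
  "diff_at c x f v = frechet_derivative (local_expr c f) (at (snd c x)) v"


section \<open>Vector fields and Kaehler forms\<close>

text \<open>Tensor fields are given by their components in every chart, subject to the usual
  transformation law. A real tangent vector at \<open>x\<close> is, in a chart around \<open>x\<close>, an element of
  \<open>\<complex>\<^sup>n = \<real>\<^sup>2\<^sup>n\<close>; the complex structure \<open>J\<close> is multiplication by \<open>\<i>\<close>, which does not depend
  on the chart because coordinate changes are holomorphic.\<close>

type_synonym ('m, 'n) vfield = "('m, 'n) chart \<Rightarrow> 'm \<Rightarrow> complex^'n"
type_synonym ('m, 'n) form2 = "('m, 'n) chart \<Rightarrow> 'm \<Rightarrow> complex^'n \<Rightarrow> complex^'n \<Rightarrow> real"

text \<open>Components outside the atlas or outside the chart domain carry no meaning and are set to 0.\<close>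

definition smooth_vfield :: "('m, 'n::finite) chart set \<Rightarrow> ('m, 'n) vfield \<Rightarrow> bool" where
  "smooth_vfield \<A> X \<longleftrightarrow>
     (\<forall>c\<in>\<A>. smooth_on (snd c ` fst c) (local_expr c (X c))) \<and>
     (\<forall>c\<in>\<A>. \<forall>d\<in>\<A>. \<forall>x\<in>fst c \<inter> fst d. X d x = diff_at c x (snd d) (X c x)) \<and>
     (\<forall>c x. c \<notin> \<A> \<or> x \<notin> fst c \<longrightarrow> X c x = 0)"

definition J_vfield :: "('m, 'n::finite) vfield \<Rightarrow> ('m, 'n) vfield" where
  "J_vfield X = (\<lambda>c x. \<i> *s X c x)"

definition lie_bracket ::
  "('m, 'n::finite) chart set \<Rightarrow> ('m, 'n) vfield \<Rightarrow> ('m, 'n) vfield \<Rightarrow> ('m, 'n) vfield" where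
  "lie_bracket \<A> X Y = (\<lambda>c x.
     if c \<in> \<A> \<and> x \<in> fst c then diff_at c x (Y c) (X c x) - diff_at c x (X c) (Y c x) else 0)"

definition smooth_form2 :: "('m, 'n::finite) chart set \<Rightarrow> ('m, 'n) form2 \<Rightarrow> bool" where
  "smooth_form2 \<A> \<omega> \<longleftrightarrow>
     (\<forall>c\<in>\<A>. \<forall>x\<in>fst c. bilinear (\<omega> c x) \<and> (\<forall>u. \<omega> c x u u = 0)) \<and>
     (\<forall>c\<in>\<A>. \<forall>u v. smooth_on (snd c ` fst c) (local_expr c (\<lambda>x. \<omega> c x u v))) \<and>
     (\<forall>c\<in>\<A>. \<forall>d\<in>\<A>. \<forall>x\<in>fst c \<inter> fst d. \<forall>u v.
        \<omega> c x u v = \<omega> d x (diff_at c x (snd d) u) (diff_at c x (snd d) v))"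

definition closed_form2 :: "('m, 'n::finite) chart set \<Rightarrow> ('m, 'n) form2 \<Rightarrow> bool" where
  "closed_form2 \<A> \<omega> \<longleftrightarrow>
     (\<forall>c\<in>\<A>. \<forall>x\<in>fst c. \<forall>u v w.
        diff_at c x (\<lambda>y. \<omega> c y v w) u + diff_at c x (\<lambda>y. \<omega> c y w u) v
          + diff_at c x (\<lambda>y. \<omega> c y u v) w = 0)"

text \<open>Sign convention: \<open>g(u,v) = \<omega>(u, J v)\<close> is the Riemannian metric; this is the convention
  under which curvature \<open>-\<i> \<omega>\<close> characterises a positive line bundle.\<close>

definition kaehler_form :: "('m, 'n::finite) chart set \<Rightarrow> ('m, 'n) form2 \<Rightarrow> bool" where
  "kaehler_form \<A> \<omega> \<longleftrightarrow>
     smooth_form2 \<A> \<omega> \<and> closed_form2 \<A> \<omega> \<and>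
     (\<forall>c\<in>\<A>. \<forall>x\<in>fst c. \<forall>u v. \<omega> c x (\<i> *s u) (\<i> *s v) = \<omega> c x u v) \<and>
     (\<forall>c\<in>\<A>. \<forall>x\<in>fst c. \<forall>u. u \<noteq> 0 \<longrightarrow> \<omega> c x u (\<i> *s u) > 0)"

definition compact_kaehler_manifold ::
  "('m::t2_space, 'n::finite) chart set \<Rightarrow> ('m, 'n) form2 \<Rightarrow> bool" where
  "compact_kaehler_manifold \<A> \<omega> \<longleftrightarrow>
     compact (UNIV :: 'm set) \<and> complex_atlas \<A> \<and> kaehler_form \<A> \<omega>"

text \<open>The real coordinate vectors \<open>\<partial>/\<partial>x\<^sub>j\<close> (\<open>False\<close>) and \<open>\<partial>/\<partial>y\<^sub>j\<close> (\<open>True\<close>), and the value of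
  \<open>w\<^sup>\<and>\<^sup>n\<close> on them in the order \<open>x\<^sub>1, y\<^sub>1, \<dots>, x\<^sub>n, y\<^sub>n\<close>:
  \<open>2\<^sup>-\<^sup>n \<Sum>\<^sub>p sgn p \<Prod>\<^sub>j w(b\<^bsub>p(2j-1)\<^esub>, b\<^bsub>p(2j)\<^esub>)\<close>. The pairs may be permuted freely, so no
  ordering of \<open>'n\<close> is needed.\<close>

fun coord_vec :: "'n::finite \<times> bool \<Rightarrow> complex^'n" where
  "coord_vec (j, b) = axis j (if b then \<i> else 1)"

definition top_power :: "(complex^'n::finite \<Rightarrow> complex^'n \<Rightarrow> real) \<Rightarrow> real" where
  "top_power w =
     (\<Sum>p | p permutes (UNIV :: ('n \<times> bool) set). of_int (sign p) *
        (\<Prod>j\<in>UNIV. w (coord_vec (p (j, False))) (coord_vec (p (j, True))))) / 2 ^ CARD('n)"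

text \<open>\<open>\<mu>\<close> is the Borel measure given by the volume form \<open>\<Omega> = \<omega>\<^sup>\<and>\<^sup>n / n!\<close>: in every chart it is
  the coefficient of \<open>\<Omega>\<close> times Lebesgue measure. This determines \<open>\<mu>\<close> uniquely.\<close>

definition volume_measure ::
  "('m::t2_space, 'n::finite) chart set \<Rightarrow> ('m, 'n) form2 \<Rightarrow> 'm measure \<Rightarrow> bool" where
  "volume_measure \<A> \<omega> \<mu> \<longleftrightarrow>
     sets \<mu> = sets borel \<and>
     (\<forall>c\<in>\<A>. \<forall>S\<in>sets borel. S \<subseteq> fst c \<longrightarrow>
        emeasure \<mu> S =
          (\<integral>\<^sup>+z. ennreal (local_expr c (\<lambda>x. top_power (\<omega> c x) / fact CARD('n)) z)
               * indicator (snd c ` S) z \<partial>lborel))"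


section \<open>Holomorphic line bundles\<close>

text \<open>The fibres are lines \<open>fibre L x\<close> in a common complex vector space \<open>'v\<close> with scalar
  multiplication \<open>scl L\<close>. This is only a device to have vector space operations on all fibres: the
  space \<open>'v\<close> carries no topology (it may be the algebraic direct sum of all the fibres), and the
  holomorphic structure is given solely by the local trivialisations. A trivialisation over \<open>U\<close> is
  recorded by its frame, the nowhere vanishing section over \<open>U\<close> corresponding to \<open>1\<close>.\<close>

record ('m, 'v) line_bundle =
  fibre :: "'m \<Rightarrow> 'v set"
  scl :: "complex \<Rightarrow> 'v \<Rightarrow> 'v"
  frames :: "('m set \<times> ('m \<Rightarrow> 'v)) set"

text \<open>\<open>quot L q v\<close> is the scalar \<open>c\<close> with \<open>v = c q\<close>, for \<open>v\<close> in the line spanned by \<open>q\<close>.\<close>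

definition quot :: "('m, 'v) line_bundle \<Rightarrow> 'v \<Rightarrow> 'v \<Rightarrow> complex" where
  "quot L q v = (THE c. v = scl L c q)"

definition hol_line_bundle ::
  "('m::t2_space, 'n::finite) chart set \<Rightarrow> ('m, 'v::ab_group_add) line_bundle \<Rightarrow> bool" where
  "hol_line_bundle \<A> L \<longleftrightarrow>
     vector_space (scl L) \<and>
     (\<forall>x. module.subspace (scl L) (fibre L x) \<and> vector_space.dim (scl L) (fibre L x) = 1) \<and>
     (\<Union>(U, e)\<in>frames L. U) = UNIV \<and>
     (\<forall>(U, e)\<in>frames L. open U \<and> (\<forall>x\<in>U. e x \<in> fibre L x \<and> e x \<noteq> 0)) \<and>
     (\<forall>(U, e)\<in>frames L. \<forall>(V, e')\<in>frames L. hol_fun_on \<A> (U \<inter> V) (\<lambda>x. quot L (e x) (e' x)))"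

definition sections :: "('m, 'v) line_bundle \<Rightarrow> ('m \<Rightarrow> 'v) set" where
  "sections L = {s. \<forall>x. s x \<in> fibre L x}"

definition fun_scl :: "('m, 'v) line_bundle \<Rightarrow> ('m \<Rightarrow> complex) \<Rightarrow> ('m \<Rightarrow> 'v) \<Rightarrow> 'm \<Rightarrow> 'v" where
  "fun_scl L f s = (\<lambda>x. scl L (f x) (s x))"

abbreviation sec_scl :: "('m, 'v) line_bundle \<Rightarrow> complex \<Rightarrow> ('m \<Rightarrow> 'v) \<Rightarrow> 'm \<Rightarrow> 'v" where
  "sec_scl L a \<equiv> fun_scl L (\<lambda>_. a)"

definition smooth_sections ::
  "('m, 'n::finite) chart set \<Rightarrow> ('m, 'v) line_bundle \<Rightarrow> ('m \<Rightarrow> 'v) set" where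
  "smooth_sections \<A> L =
     {s \<in> sections L. \<forall>(U, e)\<in>frames L. smooth_fun_on \<A> U (\<lambda>x. quot L (e x) (s x))}"

definition hol_section_on ::
  "('m, 'n::finite) chart set \<Rightarrow> ('m, 'v) line_bundle \<Rightarrow> 'm set \<Rightarrow> ('m \<Rightarrow> 'v) \<Rightarrow> bool" where
  "hol_section_on \<A> L W s \<longleftrightarrow>
     (\<forall>(U, e)\<in>frames L. hol_fun_on \<A> (U \<inter> W) (\<lambda>x. quot L (e x) (s x)))"

definition hol_sections ::
  "('m, 'n::finite) chart set \<Rightarrow> ('m, 'v) line_bundle \<Rightarrow> ('m \<Rightarrow> 'v) set" where
  "hol_sections \<A> L = {s \<in> sections L. hol_section_on \<A> L UNIV s}"

text \<open>The total space without the zero section; the bundle projection is \<open>fst\<close>.\<close>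

definition punctured :: "('m, 'v::zero) line_bundle \<Rightarrow> ('m \<times> 'v) set" where
  "punctured L = {(x, v). v \<in> fibre L x \<and> v \<noteq> 0}"

text \<open>\<open>s(\<pi>(q)) = q_hat(s) q\<close>\<close>

definition q_hat :: "('m, 'v) line_bundle \<Rightarrow> 'm \<times> 'v \<Rightarrow> ('m \<Rightarrow> 'v) \<Rightarrow> complex" where
  "q_hat L q s = quot L (snd q) (s (fst q))"


section \<open>Bases, endomorphisms and the trace\<close>

definition basis_of ::
  "(complex \<Rightarrow> 'a \<Rightarrow> 'a) \<Rightarrow> 'a::ab_group_add set \<Rightarrow> 'a set \<Rightarrow> bool" where
  "basis_of sc V B \<longleftrightarrow> \<not> module.dependent sc B \<and> module.span sc B = V"

definition endo :: "(complex \<Rightarrow> 'a \<Rightarrow> 'a) \<Rightarrow> 'a::ab_group_add set \<Rightarrow> ('a \<Rightarrow> 'a) set" where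
  "endo sc V = {A. (\<forall>s\<in>V. A s \<in> V) \<and> (\<forall>s\<in>V. \<forall>t\<in>V. A (s + t) = A s + A t) \<and>
     (\<forall>a. \<forall>s\<in>V. A (sc a s) = sc a (A s))}"

text \<open>The sum of the diagonal matrix entries in a basis of \<open>V\<close> (independent of the basis).\<close>

definition trace_on ::
  "(complex \<Rightarrow> 'a \<Rightarrow> 'a) \<Rightarrow> 'a::ab_group_add set \<Rightarrow> ('a \<Rightarrow> 'a) \<Rightarrow> complex" where
  "trace_on sc V A =
     (let B = (SOME B. basis_of sc V B) in \<Sum>b\<in>B. module.representation sc B (A b) b)"


section \<open>Very ampleness\<close>

text \<open>A basis \<open>s\<^sub>0, \<dots>, s\<^sub>N\<close> of the global holomorphic sections defines an embedding
  \<open>x \<mapsto> [s\<^sub>0(x) : \<dots> : s\<^sub>N(x)]\<close> into projective space. The homogeneous coordinates are \<open>q_hat s\<close>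
  for any nonzero \<open>q\<close> over \<open>x\<close>. The conditions say that the map is well defined, injective, and
  an immersion (in the affine charts \<open>s/t\<close> where \<open>t(x) \<noteq> 0\<close>); as the manifold is compact, it is
  then a homeomorphism onto its image.\<close>

definition very_ample ::
  "('m, 'n::finite) chart set \<Rightarrow> ('m, 'v::ab_group_add) line_bundle \<Rightarrow> bool" where
  "very_ample \<A> L \<longleftrightarrow>
     (\<exists>B. finite B \<and> basis_of (sec_scl L) (hol_sections \<A> L) B \<and>
        (\<forall>x. \<exists>s\<in>B. s x \<noteq> 0) \<and>
        (\<forall>q\<in>punctured L. \<forall>q'\<in>punctured L.
           (\<exists>a. a \<noteq> 0 \<and> (\<forall>s\<in>B. q_hat L q' s = a * q_hat L q s)) \<longrightarrow> fst q = fst q') \<and>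
        (\<forall>c\<in>\<A>. \<forall>x\<in>fst c. \<forall>t\<in>B. t x \<noteq> 0 \<longrightarrow>
           (\<forall>v. (\<forall>s\<in>B. diff_at c x (\<lambda>y. quot L (t y) (s y)) v = 0) \<longrightarrow> v = 0)))"


section \<open>Quantum line bundles\<close>

definition hermitian_metric ::
  "('m, 'n::finite) chart set \<Rightarrow> ('m, 'v::ab_group_add) line_bundle
     \<Rightarrow> ('m \<Rightarrow> 'v \<Rightarrow> 'v \<Rightarrow> complex) \<Rightarrow> bool" where
  "hermitian_metric \<A> L h \<longleftrightarrow>
     (\<forall>x. \<forall>u\<in>fibre L x. \<forall>v\<in>fibre L x.
        (\<forall>w\<in>fibre L x. h x u (v + w) = h x u v + h x u w) \<and>
        (\<forall>a. h x u (scl L a v) = a * h x u v) \<and>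
        h x v u = cnj (h x u v) \<and>
        (u \<noteq> 0 \<longrightarrow> Re (h x u u) > 0)) \<and>
     (\<forall>(U, e)\<in>frames L. smooth_fun_on \<A> U (\<lambda>x. h x (e x) (e x)))"

definition connection ::
  "('m, 'n::finite) chart set \<Rightarrow> ('m, 'v::ab_group_add) line_bundle
     \<Rightarrow> (('m, 'n) vfield \<Rightarrow> ('m \<Rightarrow> 'v) \<Rightarrow> 'm \<Rightarrow> 'v) \<Rightarrow> bool" where
  "connection \<A> L nabla \<longleftrightarrow>
     (\<forall>X s. smooth_vfield \<A> X \<and> s \<in> smooth_sections \<A> L \<longrightarrow>
        nabla X s \<in> smooth_sections \<A> L \<and>
        (\<forall>Y. smooth_vfield \<A> Y \<longrightarrow> nabla (X + Y) s = nabla X s + nabla Y s) \<and>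
        (\<forall>f :: 'm \<Rightarrow> real. smooth_fun_on \<A> UNIV f \<longrightarrow>
           nabla (\<lambda>c x. f x *\<^sub>R X c x) s = fun_scl L (\<lambda>x. of_real (f x)) (nabla X s)) \<and>
        (\<forall>t\<in>smooth_sections \<A> L. nabla X (s + t) = nabla X s + nabla X t) \<and>
        (\<forall>f :: 'm \<Rightarrow> complex. smooth_fun_on \<A> UNIV f \<longrightarrow>
           (\<forall>c\<in>\<A>. \<forall>x\<in>fst c. nabla X (fun_scl L f s) x =
              scl L (diff_at c x f (X c x)) (s x) + scl L (f x) (nabla X s x))))"

definition metric_compatible ::
  "('m, 'n::finite) chart set \<Rightarrow> ('m, 'v::ab_group_add) line_bundle
     \<Rightarrow> ('m \<Rightarrow> 'v \<Rightarrow> 'v \<Rightarrow> complex)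
     \<Rightarrow> (('m, 'n) vfield \<Rightarrow> ('m \<Rightarrow> 'v) \<Rightarrow> 'm \<Rightarrow> 'v) \<Rightarrow> bool" where
  "metric_compatible \<A> L h nabla \<longleftrightarrow>
     (\<forall>X. smooth_vfield \<A> X \<longrightarrow>
        (\<forall>s\<in>smooth_sections \<A> L. \<forall>t\<in>smooth_sections \<A> L. \<forall>c\<in>\<A>. \<forall>x\<in>fst c.
           diff_at c x (\<lambda>y. h y (s y) (t y)) (X c x) =
             h x (nabla X s x) (t x) + h x (s x) (nabla X t x)))"

text \<open>The (0,1)-part \<open>1/2 (nabla\<^sub>X + \<i> nabla\<^bsub>J X\<^esub>)\<close> of the connection annihilates local
  holomorphic sections. It suffices to look at global smooth sections that are holomorphic on some
  open set, since every germ of a holomorphic section is the germ of such a section.\<close>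

definition complex_compatible ::
  "('m::t2_space, 'n::finite) chart set \<Rightarrow> ('m, 'v::ab_group_add) line_bundle
     \<Rightarrow> (('m, 'n) vfield \<Rightarrow> ('m \<Rightarrow> 'v) \<Rightarrow> 'm \<Rightarrow> 'v) \<Rightarrow> bool" where
  "complex_compatible \<A> L nabla \<longleftrightarrow>
     (\<forall>X W. smooth_vfield \<A> X \<and> open W \<longrightarrow>
        (\<forall>s\<in>smooth_sections \<A> L. hol_section_on \<A> L W s \<longrightarrow>
           (\<forall>x\<in>W. nabla X s x + scl L \<i> (nabla (J_vfield X) s x) = 0)))"

definition quantum_condition ::
  "('m, 'n::finite) chart set \<Rightarrow> ('m, 'n) form2 \<Rightarrow> ('m, 'v::ab_group_add) line_bundle
     \<Rightarrow> (('m, 'n) vfield \<Rightarrow> ('m \<Rightarrow> 'v) \<Rightarrow> 'm \<Rightarrow> 'v) \<Rightarrow> bool" where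
  "quantum_condition \<A> \<omega> L nabla \<longleftrightarrow>
     (\<forall>X Y. smooth_vfield \<A> X \<and> smooth_vfield \<A> Y \<longrightarrow>
        (\<forall>s\<in>smooth_sections \<A> L. \<forall>c\<in>\<A>. \<forall>x\<in>fst c.
           nabla X (nabla Y s) x - nabla Y (nabla X s) x - nabla (lie_bracket \<A> X Y) s x =
             scl L (- \<i> * of_real (\<omega> c x (X c x) (Y c x))) (s x)))"

definition quantum_line_bundle ::
  "('m::t2_space, 'n::finite) chart set \<Rightarrow> ('m, 'n) form2 \<Rightarrow> ('m, 'v::ab_group_add) line_bundle
     \<Rightarrow> ('m \<Rightarrow> 'v \<Rightarrow> 'v \<Rightarrow> complex)
     \<Rightarrow> (('m, 'n) vfield \<Rightarrow> ('m \<Rightarrow> 'v) \<Rightarrow> 'm \<Rightarrow> 'v) \<Rightarrow> bool" where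
  "quantum_line_bundle \<A> \<omega> L h nabla \<longleftrightarrow>
     hol_line_bundle \<A> L \<and> hermitian_metric \<A> L h \<and> connection \<A> L nabla \<and>
     metric_compatible \<A> L h nabla \<and> complex_compatible \<A> L nabla \<and>
     quantum_condition \<A> \<omega> L nabla"


section \<open>Scalar product and Toeplitz operators\<close>

definition sprod :: "('m \<Rightarrow> 'v \<Rightarrow> 'v \<Rightarrow> complex) \<Rightarrow> 'm measure \<Rightarrow> ('m \<Rightarrow> 'v) \<Rightarrow> ('m \<Rightarrow> 'v) \<Rightarrow> complex"
  where "sprod h \<mu> s t = (\<integral>x. h x (s x) (t x) \<partial>\<mu>)"

text \<open>Representatives of the elements of \<open>L\<^sup>2(M,L)\<close>.\<close>

definition L2_sections ::
  "('m::t2_space, 'v) line_bundle \<Rightarrow> ('m \<Rightarrow> 'v \<Rightarrow> 'v \<Rightarrow> complex) \<Rightarrow> 'm measure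
     \<Rightarrow> ('m \<Rightarrow> 'v) set" where
  "L2_sections L h \<mu> =
     {s \<in> sections L.
        (\<forall>(U, e)\<in>frames L. set_borel_measurable borel U (\<lambda>x. quot L (e x) (s x))) \<and>
        integrable \<mu> (\<lambda>x. h x (s x) (s x))}"

text \<open>The orthogonal projection \<open>\<Pi>\<close> from \<open>L\<^sup>2(M,L)\<close> onto the holomorphic sections; the value
  depends only on the class of \<open>s\<close> modulo null sets.\<close>

definition hol_proj ::
  "('m::t2_space, 'n::finite) chart set \<Rightarrow> ('m, 'v::ab_group_add) line_bundle
     \<Rightarrow> ('m \<Rightarrow> 'v \<Rightarrow> 'v \<Rightarrow> complex) \<Rightarrow> 'm measure \<Rightarrow> ('m \<Rightarrow> 'v) \<Rightarrow> 'm \<Rightarrow> 'v" where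
  "hol_proj \<A> L h \<mu> s =
     (if s \<in> L2_sections L h \<mu>
      then THE t. t \<in> hol_sections \<A> L \<and> (\<forall>u\<in>hol_sections \<A> L. sprod h \<mu> u (s - t) = 0)
      else undefined)"

definition toeplitz ::
  "('m::t2_space, 'n::finite) chart set \<Rightarrow> ('m, 'v::ab_group_add) line_bundle
     \<Rightarrow> ('m \<Rightarrow> 'v \<Rightarrow> 'v \<Rightarrow> complex) \<Rightarrow> 'm measure
     \<Rightarrow> ('m \<Rightarrow> complex) \<Rightarrow> ('m \<Rightarrow> 'v) \<Rightarrow> 'm \<Rightarrow> 'v" where
  "toeplitz \<A> L h \<mu> f s = hol_proj \<A> L h \<mu> (fun_scl L f s)"

definition adjoint_op ::
  "('m, 'n::finite) chart set \<Rightarrow> ('m, 'v) line_bundle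
     \<Rightarrow> ('m \<Rightarrow> 'v \<Rightarrow> 'v \<Rightarrow> complex) \<Rightarrow> 'm measure
     \<Rightarrow> (('m \<Rightarrow> 'v) \<Rightarrow> 'm \<Rightarrow> 'v) \<Rightarrow> ('m \<Rightarrow> 'v) \<Rightarrow> 'm \<Rightarrow> 'v" where
  "adjoint_op \<A> L h \<mu> A s =
     (THE t. t \<in> hol_sections \<A> L \<and>
        (\<forall>u\<in>hol_sections \<A> L. sprod h \<mu> t u = sprod h \<mu> s (A u)))"

definition hs_prod ::
  "('m, 'n::finite) chart set \<Rightarrow> ('m, 'v::ab_group_add) line_bundle
     \<Rightarrow> ('m \<Rightarrow> 'v \<Rightarrow> 'v \<Rightarrow> complex) \<Rightarrow> 'm measure
     \<Rightarrow> (('m \<Rightarrow> 'v) \<Rightarrow> 'm \<Rightarrow> 'v) \<Rightarrow> (('m \<Rightarrow> 'v) \<Rightarrow> 'm \<Rightarrow> 'v) \<Rightarrow> complex" where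
  "hs_prod \<A> L h \<mu> A C =
     trace_on (sec_scl L) (hol_sections \<A> L) (adjoint_op \<A> L h \<mu> A \<circ> C)"


section \<open>Coherent vectors and the covariant symbol\<close>

definition coherent ::
  "('m, 'n::finite) chart set \<Rightarrow> ('m, 'v) line_bundle
     \<Rightarrow> ('m \<Rightarrow> 'v \<Rightarrow> 'v \<Rightarrow> complex) \<Rightarrow> 'm measure \<Rightarrow> 'm \<times> 'v \<Rightarrow> 'm \<Rightarrow> 'v" where
  "coherent \<A> L h \<mu> q =
     (THE e. e \<in> hol_sections \<A> L \<and> (\<forall>s\<in>hol_sections \<A> L. sprod h \<mu> e s = q_hat L q s))"

text \<open>A point \<open>q\<close> over \<open>x\<close>; what is built from it below does not depend on the choice.\<close>

definition point_over :: "('m, 'v::zero) line_bundle \<Rightarrow> 'm \<Rightarrow> 'm \<times> 'v" where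
  "point_over L x = (SOME q. q \<in> punctured L \<and> fst q = x)"

definition coherent_proj ::
  "('m, 'n::finite) chart set \<Rightarrow> ('m, 'v::ab_group_add) line_bundle
     \<Rightarrow> ('m \<Rightarrow> 'v \<Rightarrow> 'v \<Rightarrow> complex) \<Rightarrow> 'm measure \<Rightarrow> 'm \<Rightarrow> ('m \<Rightarrow> 'v) \<Rightarrow> 'm \<Rightarrow> 'v" where
  "coherent_proj \<A> L h \<mu> x s =
     (let e = coherent \<A> L h \<mu> (point_over L x)
      in sec_scl L (sprod h \<mu> e s / sprod h \<mu> e e) e)"

definition covariant_symbol ::
  "('m, 'n::finite) chart set \<Rightarrow> ('m, 'v::ab_group_add) line_bundle
     \<Rightarrow> ('m \<Rightarrow> 'v \<Rightarrow> 'v \<Rightarrow> complex) \<Rightarrow> 'm measure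
     \<Rightarrow> (('m \<Rightarrow> 'v) \<Rightarrow> 'm \<Rightarrow> 'v) \<Rightarrow> 'm \<Rightarrow> complex" where
  "covariant_symbol \<A> L h \<mu> A x =
     trace_on (sec_scl L) (hol_sections \<A> L) (A \<circ> coherent_proj \<A> L h \<mu> x)"

text \<open>\<open>\<epsilon>(x) = |q|\<^sup>2 \<langle>e\<^sub>q, e\<^sub>q\<rangle>\<close>; both factors are real.\<close>

definition epsilon ::
  "('m, 'n::finite) chart set \<Rightarrow> ('m, 'v::ab_group_add) line_bundle
     \<Rightarrow> ('m \<Rightarrow> 'v \<Rightarrow> 'v \<Rightarrow> complex) \<Rightarrow> 'm measure \<Rightarrow> 'm \<Rightarrow> real" where
  "epsilon \<A> L h \<mu> x =
     (let q = point_over L x; e = coherent \<A> L h \<mu> q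
      in Re (h x (snd q) (snd q)) * Re (sprod h \<mu> e e))"

definition eps_measure ::
  "('m, 'n::finite) chart set \<Rightarrow> ('m, 'v::ab_group_add) line_bundle
     \<Rightarrow> ('m \<Rightarrow> 'v \<Rightarrow> 'v \<Rightarrow> complex) \<Rightarrow> 'm measure \<Rightarrow> 'm measure" where
  "eps_measure \<A> L h \<mu> = density \<mu> (\<lambda>x. ennreal (epsilon \<A> L h \<mu> x))"

definition eps_prod ::
  "('m, 'n::finite) chart set \<Rightarrow> ('m, 'v::ab_group_add) line_bundle
     \<Rightarrow> ('m \<Rightarrow> 'v \<Rightarrow> 'v \<Rightarrow> complex) \<Rightarrow> 'm measure
     \<Rightarrow> ('m \<Rightarrow> complex) \<Rightarrow> ('m \<Rightarrow> complex) \<Rightarrow> complex" where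
  "eps_prod \<A> L h \<mu> g f = (\<integral>x. cnj (g x) * f x \<partial>eps_measure \<A> L h \<mu>)"

end

theory Submission
  imports Defs
begin

text \<open>
  Fix an orthonormal basis \<open>b\<^sub>i\<close> of the space of holomorphic sections. The trace of \<open>A\<^sup>* T\<^sub>f\<close> is
  \<open>\<Sum>\<^sub>i \<langle>A b\<^sub>i, T\<^sub>f b\<^sub>i\<rangle>\<close>, and the projection in \<open>T\<^sub>f\<close> disappears because \<open>A b\<^sub>i\<close> is holomorphic;
  so the left-hand side is the integral of \<open>f\<close> against the function \<open>\<Sum>\<^sub>i h(A b\<^sub>i, b\<^sub>i)\<close>. On the other
  side, the coherent vector at \<open>q\<close> represents the evaluation functional \<open>q_hat\<close> and hence has the
  coefficients \<open>cnj (q_hat b\<^sub>i)\<close> in this basis. This turns \<open>\<epsilon>(x) \<sigma>(A)(x) = |q|\<^sup>2 \<langle>e\<^sub>q, A e\<^sub>q\<rangle>\<close> into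
  \<open>\<Sum>\<^sub>i h(x)(b\<^sub>i(x), A b\<^sub>i(x))\<close> (lemma \<open>epsilon_symbol_eq\<close>), whose conjugate is the function just
  found. The weight \<open>\<epsilon>\<close> is thus exactly the factor that clears the denominator of the symbol.

  Toeplitz operators, adjoints and coherent vectors are all defined by descriptions, so the
  argument rests on the Riesz theorem for the scalar product of sections, and this requires that
  the product be finite and positive definite. Both come from one local fact
  (lemma \<open>volume_nbhd\<close>): every point has arbitrarily small open neighbourhoods whose volume is
  positive and finite. Finiteness of the total volume then follows from compactness, and
  definiteness because a nonzero section has positive length on some open set.

  The local fact needs the coefficient of \<open>\<omega>\<^sup>\<and>\<^sup>n\<close> to be positive. That coefficient is an alternating
  multilinear function of the frame on which it is evaluated, so it does not change under
  Gram-Schmidt orthogonalisation with respect to the hermitian form of \<open>\<omega>\<close>. In an orthogonal frame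
  only the permutations that preserve the pairs \<open>(u\<^sub>j, \<i> u\<^sub>j)\<close> contribute to the sum, and all their
  contributions are positive (theorem \<open>top_power_pos\<close>).
\<close>

section \<open>Positivity of the top exterior power of a positive form\<close>

text \<open>For a linear frame \<open>b\<close> this is \<open>2\<^sup>n\<close> times the value of \<open>w\<^sup>\<and>\<^sup>n\<close> on \<open>b\<close>. Unlike
  \<^const>\<open>top_power\<close>, which fixes the coordinate frame, it lets the frame vary, so that column operations
  can be performed on it.\<close>

definition wedge :: "('a \<Rightarrow> 'a \<Rightarrow> real) \<Rightarrow> ('n::finite \<times> bool \<Rightarrow> 'a) \<Rightarrow> real" where
  "wedge w b = (\<Sum>p | p permutes (UNIV :: ('n \<times> bool) set). of_int (sign p) *
        (\<Prod>j\<in>UNIV. w (b (p (j, False))) (b (p (j, True)))))"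

text \<open>Composing the summation permutation with the transposition of \<open>k\<close> and \<open>l\<close> flips the sign of
  every summand and, the two entries being equal, changes nothing else.\<close>

lemma wedge_alternating:
  assumes "k \<noteq> l" "b k = b l"
  shows "wedge w b = 0"
proof -
  let ?t = "Transposition.transpose k l"
  have t: "?t permutes UNIV" by (rule permutes_swap_id) auto
  have bt: "b (?t y) = b y" for y using assms by (auto simp: Transposition.transpose_def)
  have "wedge w b = (\<Sum>p | p permutes (UNIV :: ('a \<times> bool) set). of_int (sign (?t \<circ> p)) *
        (\<Prod>j\<in>UNIV. w (b ((?t \<circ> p) (j, False))) (b ((?t \<circ> p) (j, True)))))"
    unfolding wedge_def by (rule setum_permutations_compose_left[OF t])
  also have "\<dots> = - wedge w b"
    unfolding wedge_def sum_negf[symmetric]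
  proof (rule sum.cong[OF refl])
    fix p :: "'a \<times> bool \<Rightarrow> 'a \<times> bool" assume "p \<in> {p. p permutes UNIV}"
    then have "permutation p" by (simp add: permutes_imp_permutation[OF finite])
    then have "sign (?t \<circ> p) = - sign p"
      using assms(1) by (simp add: sign_compose permutation_swap_id sign_swap_id)
    then show "of_int (sign (?t \<circ> p)) * (\<Prod>j\<in>UNIV. w (b ((?t \<circ> p) (j, False))) (b ((?t \<circ> p) (j, True))))
      = - (of_int (sign p) * (\<Prod>j\<in>UNIV. w (b (p (j, False))) (b (p (j, True)))))"
      by (simp add: bt)
  qed
  finally show ?thesis by simp
qed

text \<open>In each summand the index \<open>k\<close> occurs in exactly one factor, and there in exactly one
  argument of \<open>w\<close>.\<close>

lemma linear_wedge:
  fixes b :: "'n::finite \<times> bool \<Rightarrow> 'a::real_vector"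
  assumes w: "bilinear w"
  shows "linear (\<lambda>x. wedge w (b(k := x)))"
  unfolding wedge_def
proof (rule linear_compose_sum, safe)
  fix p :: "'n \<times> bool \<Rightarrow> 'n \<times> bool" assume p: "p permutes UNIV"
  have "surj p" using p by (rule permutes_surj)
  then obtain y where "p y = k" by (metis surjD)
  then obtain j0 c where jc: "p (j0, c) = k" by (cases y) auto
  have other: "p (j, d) \<noteq> k" if "(j, d) \<noteq> (j0, c)" for j d
    using that injD[OF permutes_inj[OF p], of "(j, d)" "(j0, c)"] jc by auto
  let ?F = "\<lambda>x j. w ((b(k := x)) (p (j, False))) ((b(k := x)) (p (j, True)))"
  have rest: "(\<Prod>j\<in>UNIV-{j0}. ?F x j) = (\<Prod>j\<in>UNIV-{j0}. w (b (p (j, False))) (b (p (j, True))))" for x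
    by (rule prod.cong) (auto simp: other)
  have split: "(\<Prod>j\<in>UNIV. ?F x j)
      = ?F x j0 * (\<Prod>j\<in>UNIV-{j0}. w (b (p (j, False))) (b (p (j, True))))" for x
    using prod.remove[of UNIV j0 "?F x"] rest[of x] by simp
  have lin: "linear (\<lambda>x. ?F x j0)"
  proof (cases c)
    case True
    then have "(\<lambda>x. ?F x j0) = w (b (p (j0, False)))" using jc other[of j0 False] by auto
    then show ?thesis using w by (simp add: bilinear_def)
  next
    case False
    then have "(\<lambda>x. ?F x j0) = (\<lambda>x. w x (b (p (j0, True))))" using jc other[of j0 True] by auto
    then show ?thesis using w by (simp add: bilinear_def)
  qed
  show "linear (\<lambda>x. of_int (sign p) * (\<Prod>j\<in>UNIV. ?F x j))"
    unfolding split
    using lin by (simp add: linear_iff algebra_simps)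
qed

lemma wedge_shift:
  fixes b :: "'n::finite \<times> bool \<Rightarrow> 'a::real_vector"
  assumes w: "bilinear w" and "k \<noteq> l" "k \<noteq> m"
  shows "wedge w (b(k := b k + r *\<^sub>R b l + s *\<^sub>R b m)) = wedge w b"
proof -
  interpret linear "\<lambda>x. wedge w (b(k := x))" by (rule linear_wedge[OF w])
  have "wedge w (b(k := b l)) = 0" using assms by (intro wedge_alternating[of k l]) auto
  moreover have "wedge w (b(k := b m)) = 0" using assms by (intro wedge_alternating[of k m]) auto
  ultimately show ?thesis by (simp add: add scale)
qed

definition real_frame :: "('n \<Rightarrow> complex^'n) \<Rightarrow> 'n \<times> bool \<Rightarrow> complex^'n" where
  "real_frame u = (\<lambda>(j, b). if b then \<i> *s u j else u j)"

lemma scaleC_decomp: "c *s (x :: complex^'n) = Re c *\<^sub>R x + Im c *\<^sub>R (\<i> *s x)"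
  unfolding vec_eq_iff by (auto intro!: complex_eqI)

lemma scaleC_i_decomp: "\<i> *s (c *s (x :: complex^'n)) = Re c *\<^sub>R (\<i> *s x) + (- Im c) *\<^sub>R x"
  unfolding vec_eq_iff by (auto intro!: complex_eqI)

text \<open>A complex column operation on \<open>u\<close> moves both real vectors \<open>u k\<close> and \<open>\<i> u k\<close>, so it is the
  succession of two real ones.\<close>

lemma wedge_frame_shift:
  fixes u :: "'n::finite \<Rightarrow> complex^'n"
  assumes w: "bilinear w" and "k \<noteq> l"
  shows "wedge w (real_frame (u(k := u k + c *s u l))) = wedge w (real_frame u)"
proof -
  define b where "b = real_frame u"
  define b1 where "b1 = b((k, False) := b (k, False) + Re c *\<^sub>R b (l, False) + Im c *\<^sub>R b (l, True))"
  define b2 where "b2 = b1((k, True) := b1 (k, True) + Re c *\<^sub>R b1 (l, True) + (- Im c) *\<^sub>R b1 (l, False))"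
  have kF: "real_frame (u(k := u k + c *s u l)) (k, False) = b2 (k, False)"
    unfolding real_frame_def b2_def b1_def b_def by (simp add: add.assoc flip: scaleC_decomp)
  have kT: "real_frame (u(k := u k + c *s u l)) (k, True) = b2 (k, True)"
    using \<open>k \<noteq> l\<close> \<open>k \<noteq> l\<close>[symmetric] unfolding real_frame_def b2_def b1_def b_def
    by (simp only: scaleC_i_decomp vector_add_ldistrib add.assoc fun_upd_apply prod.case prod.inject
        if_True if_False simp_thms)
  have "real_frame (u(k := u k + c *s u l)) (j, d) = b2 (j, d)" if "j \<noteq> k" for j d
    using that by (simp add: real_frame_def b2_def b1_def b_def)
  then have "real_frame (u(k := u k + c *s u l)) y = b2 y" for y
    using kF kT by (cases y; cases "fst y = k"; cases "snd y") auto
  then have "wedge w (real_frame (u(k := u k + c *s u l))) = wedge w b2" by presburger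
  also have "wedge w b2 = wedge w b1"
    unfolding b2_def using \<open>k \<noteq> l\<close>
    by (intro wedge_shift[OF w, of "(k, True)" "(l, True)" "(l, False)" b1 "Re c" "- Im c"]) simp_all
  also have "wedge w b1 = wedge w b"
    unfolding b1_def using \<open>k \<noteq> l\<close>
    by (intro wedge_shift[OF w, of "(k, False)" "(l, False)" "(l, True)" b "Re c" "Im c"]) simp_all
  finally show ?thesis by (simp add: b_def)
qed

lemma wedge_frame_shift_sum:
  fixes u :: "'n::finite \<Rightarrow> complex^'n"
  assumes w: "bilinear w" and "k \<notin> S"
  shows "wedge w (real_frame (u(k := u k + (\<Sum>l\<in>S. c l *s u l)))) = wedge w (real_frame u)"
  using finite[of S] \<open>k \<notin> S\<close>
proof (induction S rule: finite_induct)
  case (insert l S)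
  let ?u = "u(k := u k + (\<Sum>l\<in>S. c l *s u l))"
  have "u(k := u k + (\<Sum>l\<in>insert l S. c l *s u l)) = ?u(k := ?u k + c l *s ?u l)"
    using insert by (auto simp: algebra_simps)
  then have "wedge w (real_frame (u(k := u k + (\<Sum>l\<in>insert l S. c l *s u l))))
    = wedge w (real_frame (?u(k := ?u k + c l *s ?u l)))" by simp
  also have "\<dots> = wedge w (real_frame ?u)"
    using insert wedge_frame_shift[OF w, of k l ?u "c l"] by blast
  also have "\<dots> = wedge w (real_frame u)" using insert by blast
  finally show ?case .
qed simp

lemma sign_flip:
  fixes D :: "'n::finite set"
  defines "fl \<equiv> \<lambda>D (j, b). (j, if j \<in> D then \<not> b else b)"
  shows "permutation (fl D) \<and> sign (fl D) = (- 1) ^ card D"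
  using finite[of D]
proof (induction D rule: finite_induct)
  case empty
  have "fl {} = (id :: 'n \<times> bool \<Rightarrow> _)" by (auto simp: fl_def)
  then show ?case by (simp add: sign_id)
next
  case (insert j D)
  have "fl (insert j D) = Transposition.transpose (j, False) (j, True) \<circ> fl D"
    using insert by (auto simp: fl_def Transposition.transpose_def fun_eq_iff)
  moreover have "permutation (Transposition.transpose (j, False) (j, True) \<circ> fl D)"
    using insert by (intro permutation_compose permutation_swap_id) simp
  moreover have "sign (Transposition.transpose (j, False) (j, True) \<circ> fl D) = - ((- 1) ^ card D)"
    using insert by (subst sign_compose) (auto simp: permutation_swap_id sign_swap_id)
  ultimately show ?case
    using insert(1,2) by (simp only: card_insert_disjoint power_Suc mult_minus_left mult_1_left simp_thms)
qed

lemma sign_map_prod_id: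
  fixes q :: "'n::finite \<Rightarrow> 'n"
  assumes "q permutes UNIV"
  shows "permutation (map_prod q (id :: bool \<Rightarrow> bool)) \<and> sign (map_prod q (id :: bool \<Rightarrow> bool)) = 1"
  using assms
proof (induction q rule: permutes_induct[OF _ finite, consumes 1, case_names id swap])
  case id
  then show ?case by (simp add: map_prod.id)
next
  case (swap a b p)
  have "map_prod (Transposition.transpose a b \<circ> p) (id :: bool \<Rightarrow> bool)
      = (Transposition.transpose (a, False) (b, False) \<circ> Transposition.transpose (a, True) (b, True)) \<circ> map_prod p id"
    by (auto simp: Transposition.transpose_def fun_eq_iff)
  moreover have T: "permutation (Transposition.transpose (a, False) (b, False) \<circ> Transposition.transpose (a, True) (b, True))"
    by (intro permutation_compose permutation_swap_id)
  moreover have "sign (Transposition.transpose (a, False) (b, False) \<circ> Transposition.transpose (a, True) (b, True)) = 1"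
    by (subst sign_compose) (simp_all add: permutation_swap_id sign_swap_id)
  ultimately show ?case
    using swap permutation_compose[OF T, of "map_prod p id"] sign_compose[OF T, of "map_prod p id"]
    by presburger
qed

text \<open>Such a permutation first flips some of the pairs and then permutes the pairs. The permutation
  of the pairs is even, since it acts simultaneously on the first and on the second members; each
  flip is a transposition.\<close>

lemma sign_pair_preserving:
  fixes p :: "'n::finite \<times> bool \<Rightarrow> 'n \<times> bool"
  assumes p: "p permutes UNIV" and pair: "\<And>j. fst (p (j, False)) = fst (p (j, True))"
  shows "sign p = (\<Prod>j\<in>UNIV. if snd (p (j, False)) then - 1 else 1)"
proof -
  define q where "q = (\<lambda>j. fst (p (j, False)))"
  define D where "D = {j. snd (p (j, False))}"
  have inj: "inj p" and surj: "surj p" using permutes_inj[OF p] permutes_surj[OF p] .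
  have snd_True: "snd (p (j, True)) \<longleftrightarrow> \<not> snd (p (j, False))" for j
    using injD[OF inj, of "(j, False)" "(j, True)"] pair[of j] by (auto simp: prod_eq_iff)
  have "surj q"
  proof
    show "UNIV \<subseteq> range q"
    proof
      fix m
      obtain j b where "p (j, b) = (m, False)" using surj by (metis surjD surj_pair)
      then have "q j = m" using pair[of j] by (cases b) (auto simp: q_def)
      then show "m \<in> range q" by auto
    qed
  qed auto
  then have q: "q permutes UNIV"
    by (intro bij_imp_permutes) (auto simp: bij_def finite_UNIV_surj_inj)
  have "p = map_prod q id \<circ> (\<lambda>(j, b). (j, if j \<in> D then \<not> b else b))"
  proof
    fix y :: "'n \<times> bool"
    obtain j b where y: "y = (j, b)" by force
    show "p y = (map_prod q id \<circ> (\<lambda>(j, b). (j, if j \<in> D then \<not> b else b))) y"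
      unfolding y using pair[of j] snd_True[of j] by (cases b) (auto simp: q_def D_def prod_eq_iff)
  qed
  then have "sign p = (- 1) ^ card D"
    using sign_flip[of D] sign_map_prod_id[OF q] by (simp add: sign_compose)
  also have "\<dots> = (\<Prod>j\<in>UNIV. if j \<in> D then - 1 else 1)"
    by (simp add: prod.If_cases)
  finally show ?thesis by (simp add: D_def)
qed

text \<open>These are the properties of a Kaehler form at a point. They say that \<open>w(u, \<i> v) + \<i> w(u, v)\<close>
  is a positive definite hermitian form; \<open>perp\<close> below is orthogonality for it.\<close>

locale positive_form =
  fixes w :: "complex^'n::finite \<Rightarrow> complex^'n \<Rightarrow> real"
  assumes bilinear_w: "bilinear w"
    and alternating_w: "w u u = 0"
    and J_invariant: "w (\<i> *s u) (\<i> *s v) = w u v"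
    and positive_w: "u \<noteq> 0 \<Longrightarrow> w u (\<i> *s u) > 0"
begin

definition perp :: "complex^'n \<Rightarrow> complex^'n \<Rightarrow> bool" where
  "perp u v \<longleftrightarrow> w u v = 0 \<and> w u (\<i> *s v) = 0"

lemma skew: "w u v = - w v u"
proof -
  have "0 = w (u + v) (u + v)" by (simp only: alternating_w)
  also have "\<dots> = w u v + w v u"
    unfolding bilinear_ladd[OF bilinear_w] bilinear_radd[OF bilinear_w] by (simp add: alternating_w)
  finally show ?thesis by linarith
qed

lemma i_i: "\<i> *s (\<i> *s (x :: complex^'n)) = - x"
  by (simp add: vec_eq_iff)

lemma i_scaleR: "\<i> *s (r *\<^sub>R x :: complex^'n) = r *\<^sub>R (\<i> *s x)"
  by (simp add: vec_eq_iff)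

lemma i_left: "w (\<i> *s u) v = - w u (\<i> *s v)"
  using J_invariant[of u "\<i> *s v"] by (simp only: i_i bilinear_rneg[OF bilinear_w])

lemma perp_sym: "perp u v \<Longrightarrow> perp v u"
  unfolding perp_def by (metis skew i_left neg_equal_0_iff_equal)

lemma perp_add_scale: "perp u v \<Longrightarrow> perp u v' \<Longrightarrow> perp u (v + c *s v')"
  unfolding perp_def
  by (simp add: scaleC_decomp[of c] vector_add_ldistrib i_i i_scaleR
      bilinear_radd[OF bilinear_w] bilinear_rsub[OF bilinear_w] bilinear_rmul[OF bilinear_w] bilinear_rneg[OF bilinear_w])

lemma perp_sum: "(\<And>l. l \<in> S \<Longrightarrow> perp u (v l)) \<Longrightarrow> perp u (\<Sum>l\<in>S. c l *s v l)"
proof (induction S rule: infinite_finite_induct)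
  case (insert x F)
  then show ?case using perp_add_scale[of u "\<Sum>l\<in>F. c l *s v l" "v x" "c x"] by (simp add: add.commute)
qed (auto simp: perp_def bilinear_rzero[OF bilinear_w])

lemma perp_project: "u \<noteq> 0 \<Longrightarrow> \<exists>c. perp u (v + c *s u)"
proof -
  assume "u \<noteq> 0"
  then have N: "w u (\<i> *s u) > 0" by (rule positive_w)
  \<comment> \<open>The real and imaginary part solve the two equations of \<open>perp\<close>, which decouple since \<open>w u u = 0\<close>.\<close>
  define c where "c = Complex (- (w u (\<i> *s v) / w u (\<i> *s u))) (- (w u v / w u (\<i> *s u)))"
  have "perp u (v + c *s u)"
    using N unfolding perp_def scaleC_decomp[of c] vector_add_ldistrib
    by (simp add: c_def i_i alternating_w i_scaleR
      bilinear_radd[OF bilinear_w] bilinear_rsub[OF bilinear_w] bilinear_rmul[OF bilinear_w] bilinear_rneg[OF bilinear_w])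
  then show ?thesis ..
qed

text \<open>Gram-Schmidt orthogonalisation of the coordinate frame, over a growing set \<open>S\<close> of indices.
  The vectors treated so far are supported in \<open>S\<close>, so correcting the next basis vector by them
  keeps its own component equal to 1; this is why no vector of the new frame vanishes.\<close>

lemma orthogonal_frame:
  "\<exists>u :: 'n \<Rightarrow> complex^'n. (\<forall>j\<in>S. u j \<noteq> 0 \<and> (\<forall>i. i \<notin> S \<longrightarrow> u j $ i = 0)) \<and> (\<forall>j. j \<notin> S \<longrightarrow> u j = axis j 1)
     \<and> (\<forall>j\<in>S. \<forall>l\<in>S. j \<noteq> l \<longrightarrow> perp (u j) (u l))
     \<and> wedge w (real_frame u) = wedge w (real_frame (\<lambda>j. axis j 1))"
  using finite[of S]
proof (induction S rule: finite_induct)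
  case (insert k S)
  from insert.IH obtain u :: "'n \<Rightarrow> complex^'n" where
    nz: "\<forall>j\<in>S. u j \<noteq> 0 \<and> (\<forall>i. i \<notin> S \<longrightarrow> u j $ i = 0)" and out: "\<forall>j. j \<notin> S \<longrightarrow> u j = axis j 1"
    and orth: "\<forall>j\<in>S. \<forall>l\<in>S. j \<noteq> l \<longrightarrow> perp (u j) (u l)"
    and eq: "wedge w (real_frame u) = wedge w (real_frame (\<lambda>j. axis j 1))"
    by (elim exE conjE)
  have u: "\<And>j. j \<in> S \<Longrightarrow> u j \<noteq> 0" "\<And>j i. j \<in> S \<Longrightarrow> i \<notin> S \<Longrightarrow> u j $ i = 0"
      "\<And>j. j \<notin> S \<Longrightarrow> u j = axis j 1"
    using nz out by simp_all
  have perp: "\<And>j l. j \<in> S \<Longrightarrow> l \<in> S \<Longrightarrow> j \<noteq> l \<Longrightarrow> perp (u j) (u l)" using orth by simp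
  have "\<forall>j\<in>S. \<exists>c. perp (u j) (u k + c *s u j)" using perp_project[OF u(1)] by simp
  then obtain c where c: "\<And>j. j \<in> S \<Longrightarrow> perp (u j) (u k + c j *s u j)" by metis
  let ?v = "u k + (\<Sum>l\<in>S. c l *s u l)"
  have vk: "?v $ k = 1"
    using insert(2) u(2)[of _ k] by (simp add: u(3))
  have v0: "?v $ i = 0" if "i \<notin> insert k S" for i
    using that insert(2) u(2)[of _ i] by (simp add: u(3) axis_def)
  have vperp: "perp (u j) ?v" if "j \<in> S" for j
  proof -
    have "?v = (u k + c j *s u j) + 1 *s (\<Sum>l\<in>S-{j}. c l *s u l)"
      using that insert(1) by (simp add: sum.remove add.assoc)
    then show ?thesis
      using perp_add_scale[OF c[OF that] perp_sum[of "S-{j}" "u j" u c], of 1] perp[OF that]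
      by (auto simp: add.assoc)
  qed
  define u' where "u' = u(k := ?v)"
  have u'k: "u' k = ?v" and u': "\<And>j. j \<noteq> k \<Longrightarrow> u' j = u j" by (simp_all add: u'_def)
  have "u' k \<noteq> 0" using vk unfolding u'k[symmetric] by (metis zero_index zero_neq_one)
  moreover have "u' k $ i = 0" if "i \<notin> insert k S" for i using v0[OF that] u'k by simp
  ultimately have "\<forall>j\<in>insert k S. u' j \<noteq> 0 \<and> (\<forall>i. i \<notin> insert k S \<longrightarrow> u' j $ i = 0)"
    using u(1,2) u' by (metis insert_iff)
  moreover have "\<forall>j. j \<notin> insert k S \<longrightarrow> u' j = axis j 1" using u(3) u' by simp
  moreover have "\<forall>j\<in>insert k S. \<forall>l\<in>insert k S. j \<noteq> l \<longrightarrow> perp (u' j) (u' l)"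
  proof (intro ballI impI)
    fix j l assume "j \<in> insert k S" "l \<in> insert k S" "j \<noteq> l"
    then consider "j = k" "l \<in> S" "l \<noteq> k" | "l = k" "j \<in> S" "j \<noteq> k" | "j \<in> S" "l \<in> S" "j \<noteq> k" "l \<noteq> k"
      by blast
    then show "perp (u' j) (u' l)"
      by cases (simp_all only: u'k u' vperp perp_sym[OF vperp] perp \<open>j \<noteq> l\<close> not_False_eq_True)
  qed
  moreover have "wedge w (real_frame u') = wedge w (real_frame (\<lambda>j. axis j 1))"
    unfolding u'_def wedge_frame_shift_sum[OF bilinear_w insert(2)] by (rule eq)
  ultimately show ?case by (intro exI[of _ u'] conjI)
qed auto

text \<open>A summand survives only if its permutation maps pairs to pairs. Its product then carries one
  factor \<open>-1\<close> for each flipped pair, and these signs are cancelled by the sign of the permutation.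
  Every summand is therefore nonnegative, and the one of the identity is positive.\<close>

lemma wedge_orthogonal_pos:
  fixes u :: "'n \<Rightarrow> complex^'n"
  assumes nz: "\<And>j. u j \<noteq> 0" and perp: "\<And>j l. j \<noteq> l \<Longrightarrow> perp (u j) (u l)"
  shows "wedge w (real_frame u) > 0"
proof -
  let ?b = "real_frame u"
  let ?T = "\<lambda>p. of_int (sign p) * (\<Prod>j\<in>UNIV. w (?b (p (j, False))) (?b (p (j, True))))"
  define N where "N = (\<lambda>j. w (u j) (\<i> *s u j))"
  have N: "N j > 0" for j unfolding N_def by (rule positive_w[OF nz])
  have off: "w (?b y) (?b z) = 0" if "fst y \<noteq> fst z" for y z
    using perp[OF that] by (auto simp: perp_def real_frame_def i_left J_invariant i_i bilinear_rneg[OF bilinear_w] split: prod.splits)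
  have on: "w (?b y) (?b z) = (if snd y then - 1 else 1) * N (fst y)"
    if "fst y = fst z" "y \<noteq> z" for y z
    using that by (cases y; cases z) (auto simp: real_frame_def N_def i_left i_i alternating_w bilinear_rneg[OF bilinear_w] skew[of "\<i> *s _"])
  have nonneg: "?T p \<ge> 0" if p: "p permutes UNIV" for p :: "'n \<times> bool \<Rightarrow> 'n \<times> bool"
  proof (cases "\<forall>j. fst (p (j, False)) = fst (p (j, True))")
    case True
    have ne: "p (j, False) \<noteq> p (j, True)" for j
      using permutes_inj[OF p] by (auto dest: injD)
    have "(\<Prod>j\<in>UNIV. w (?b (p (j, False))) (?b (p (j, True))))
        = (\<Prod>j\<in>UNIV. (if snd (p (j, False)) then - 1 else 1) * N (fst (p (j, False))))"
      using True ne by (intro prod.cong refl on) auto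
    also have "\<dots> = of_int (sign p) * (\<Prod>j\<in>UNIV. N (fst (p (j, False))))"
      using True by (subst sign_pair_preserving[OF p]) (auto simp: prod.distrib intro!: prod.cong)
    finally have "?T p = (of_int (sign p) * of_int (sign p)) * (\<Prod>j\<in>UNIV. N (fst (p (j, False))))"
      by (simp only: mult.assoc)
    also have "\<dots> = (\<Prod>j\<in>UNIV. N (fst (p (j, False))))"
      by (simp only: sign_idempotent of_int_1 mult_1_left flip: of_int_mult)
    finally show ?thesis using N by (simp add: prod_nonneg less_imp_le)
  next
    case False
    then obtain j where "fst (p (j, False)) \<noteq> fst (p (j, True))" by blast
    then have "(\<Prod>j\<in>UNIV. w (?b (p (j, False))) (?b (p (j, True)))) = 0"
      by (intro prod_zero bexI[of _ j] off) auto
    then show ?thesis by (simp only: mult_zero_right order_refl)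
  qed
  have "0 < (\<Prod>j\<in>UNIV. N j)" using N by (simp add: prod_pos)
  also have "\<dots> = ?T id" by (simp add: sign_id real_frame_def N_def)
  also have "\<dots> \<le> wedge w ?b"
    unfolding wedge_def
  proof (rule member_le_sum)
    show "id \<in> {p. p permutes (UNIV :: ('n \<times> bool) set)}" by (simp only: mem_Collect_eq permutes_id)
    show "finite {p. p permutes (UNIV :: ('n \<times> bool) set)}" by (rule finite_permutations[OF finite])
    show "0 \<le> ?T p" if "p \<in> {p. p permutes (UNIV :: ('n \<times> bool) set)} - {id}" for p
      using that by (intro nonneg) blast
  qed
  finally show ?thesis .
qed

theorem top_power_pos: "top_power w > 0"
proof -
  obtain u where "\<And>j. u j \<noteq> 0" "\<And>j l. j \<noteq> l \<Longrightarrow> perp (u j) (u l)"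
    and eq: "wedge w (real_frame u) = wedge w (real_frame (\<lambda>j. axis j 1))"
    using orthogonal_frame[of UNIV] by auto
  then have "wedge w (real_frame (\<lambda>j :: 'n. axis j 1)) > 0" using wedge_orthogonal_pos by metis
  moreover have "real_frame (\<lambda>j :: 'n. axis j 1) = coord_vec"
    by (auto simp: real_frame_def fun_eq_iff vec_eq_iff axis_def)
  ultimately show ?thesis by (simp add: top_power_def wedge_def)
qed

end

section \<open>Traces and the Riesz theorem on finite-dimensional hermitian spaces\<close>

text \<open>The space is a subset \<open>V\<close> of an ambient vector space, as holomorphic sections are a subset of
  all bundle-valued functions.\<close>

locale hermitian_space = vector_space sc
  for sc :: "complex \<Rightarrow> 'a::ab_group_add \<Rightarrow> 'a" +
  fixes V :: "'a set" and ip :: "'a \<Rightarrow> 'a \<Rightarrow> complex"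
  assumes finite_generated: "\<exists>B. finite B \<and> span B = V"
    and ip_add: "s \<in> V \<Longrightarrow> t \<in> V \<Longrightarrow> u \<in> V \<Longrightarrow> ip s (t + u) = ip s t + ip s u"
    and ip_scale: "s \<in> V \<Longrightarrow> t \<in> V \<Longrightarrow> ip s (sc a t) = a * ip s t"
    and ip_cnj: "s \<in> V \<Longrightarrow> t \<in> V \<Longrightarrow> ip t s = cnj (ip s t)"
    and ip_pos: "s \<in> V \<Longrightarrow> s \<noteq> 0 \<Longrightarrow> Re (ip s s) > 0"
begin

lemma subspace_V: "subspace V"
  using finite_generated by auto

lemmas V_intros = subspace_0[OF subspace_V] subspace_add[OF subspace_V] subspace_scale[OF subspace_V]
  subspace_diff[OF subspace_V] subspace_sum[OF subspace_V]

lemma ip_zero: "s \<in> V \<Longrightarrow> ip s 0 = 0"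
  using ip_scale[of s 0 0] V_intros(1) by simp

lemma ip_diff: "s \<in> V \<Longrightarrow> t \<in> V \<Longrightarrow> u \<in> V \<Longrightarrow> ip s (t - u) = ip s t - ip s u"
  using ip_add[of s "t - u" u] V_intros(4) by simp

lemma ip_sum: "s \<in> V \<Longrightarrow> (\<And>i. i \<in> I \<Longrightarrow> t i \<in> V) \<Longrightarrow> ip s (\<Sum>i\<in>I. sc (c i) (t i)) = (\<Sum>i\<in>I. c i * ip s (t i))"
proof (induction I rule: infinite_finite_induct)
  case (insert i I)
  have "(\<Sum>i\<in>I. sc (c i) (t i)) \<in> V" using insert V_intros by (intro subspace_sum[OF subspace_V]) simp
  then show ?case using insert V_intros(3) by (simp add: ip_add ip_scale)
qed (simp_all add: ip_zero)

lemma ip_self_eq_0: "s \<in> V \<Longrightarrow> ip s s = 0 \<Longrightarrow> s = 0"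
  using ip_pos by fastforce

lemma ip_eqI:
  assumes "s \<in> V" "t \<in> V" "\<And>u. u \<in> V \<Longrightarrow> ip u s = ip u t"
  shows "s = t"
  using ip_self_eq_0[of "s - t"] assms V_intros(4) by (simp add: ip_diff)

lemma ip_real: "s \<in> V \<Longrightarrow> ip s s = of_real (Re (ip s s))"
  using ip_cnj[of s s] by (simp add: complex_eq_iff)

definition orthonormal_basis :: "'a set \<Rightarrow> bool" where
  "orthonormal_basis E \<longleftrightarrow> finite E \<and> E \<subseteq> V \<and> (\<forall>e\<in>E. \<forall>e'\<in>E. ip e e' = (if e = e' then 1 else 0))
     \<and> (\<forall>s\<in>V. s = (\<Sum>e\<in>E. sc (ip e s) e))"

text \<open>Gram-Schmidt again: the part of a new vector orthogonal to the span of \<open>E\<close> is either zero,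
  and then the span already contains the vector, or can be normalised and adjoined to \<open>E\<close>.\<close>

lemma orthonormal_span:
  assumes "finite B" "B \<subseteq> V"
  shows "\<exists>E. finite E \<and> E \<subseteq> V \<and> (\<forall>e\<in>E. \<forall>e'\<in>E. ip e e' = (if e = e' then 1 else 0)) \<and> B \<subseteq> span E"
  using assms
proof (induction B rule: finite_induct)
  case empty
  then show ?case by (intro exI[of _ "{}"]) auto
next
  case (insert b B)
  have "B \<subseteq> V" using insert.prems by simp
  from insert.IH[OF this] obtain E where E: "finite E" "E \<subseteq> V"
    and ortho: "\<forall>e\<in>E. \<forall>e'\<in>E. ip e e' = (if e = e' then 1 else 0)" and BE: "B \<subseteq> span E"
    by (elim exE conjE)
  have bV: "b \<in> V" using insert by auto
  define p where "p = (\<Sum>e\<in>E. sc (ip e b) e)"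
  have pV: "p \<in> V" unfolding p_def using E by (intro subspace_sum[OF subspace_V] V_intros(3)) auto
  have pE: "p \<in> span E" unfolding p_def by (intro span_sum span_scale span_base)
  define r where "r = b - p"
  have rV: "r \<in> V" using bV pV V_intros(4) r_def by auto
  have orth: "ip e r = 0" if e: "e \<in> E" for e
  proof -
    have eV: "e \<in> V" using e E by auto
    have "ip e p = (\<Sum>e'\<in>E. ip e' b * ip e e')"
      unfolding p_def using eV E(2) by (intro ip_sum) auto
    also have "\<dots> = (\<Sum>e'\<in>E. if e' = e then ip e b else 0)"
      using e by (intro sum.cong) (auto simp: ortho)
    also have "\<dots> = ip e b" using E(1) e by simp
    finally show ?thesis using eV bV pV by (simp add: r_def ip_diff)
  qed
  show ?case
  proof (cases "r = 0")
    case True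
    then have "b \<in> span E" using pE r_def by simp
    then show ?thesis using E ortho BE by (intro exI[of _ E]) simp
  next
    case False
    define a where "a = sqrt (Re (ip r r))"
    have a: "a > 0" "a * a = Re (ip r r)" using ip_pos[OF rV False] by (auto simp: a_def)
    define e where "e = sc (of_real (1 / a)) r"
    have eV: "e \<in> V" using rV V_intros(3) e_def by auto
    have "ip r e = of_real a"
      using a ip_real[OF rV] rV by (simp add: e_def ip_scale flip: of_real_mult of_real_divide)
        (simp add: a(2)[symmetric])
    then have "ip e r = of_real a" using ip_cnj[OF rV eV] by simp
    then have ee: "ip e e = 1" using a rV eV by (subst (2) e_def) (simp add: ip_scale)
    have e1: "ip e' e = 0" "ip e e' = 0" if "e' \<in> E" for e'
    proof -
      have e'V: "e' \<in> V" using that E by auto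
      show "ip e' e = 0" unfolding e_def using orth[OF that] rV e'V by (simp add: ip_scale)
      then show "ip e e' = 0" using ip_cnj[OF e'V eV] by simp
    qed
    have "r = sc (of_real a) e" using a by (simp add: e_def)
    then have "b = sc (of_real a) e + p" using r_def by (simp add: algebra_simps)
    moreover have "p \<in> span (insert e E)" using pE span_mono[of E "insert e E"] by auto
    ultimately have "b \<in> span (insert e E)" by (simp add: span_add span_scale span_base)
    moreover have "B \<subseteq> span (insert e E)" using BE span_mono[of E "insert e E"] by auto
    ultimately have "insert b B \<subseteq> span (insert e E)" by simp
    moreover have "\<forall>x\<in>insert e E. \<forall>y\<in>insert e E. ip x y = (if x = y then 1 else 0)"
    proof (intro ballI)
      fix x y assume "x \<in> insert e E" "y \<in> insert e E"
      moreover have "e \<notin> E" using e1 ee by fastforce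
      ultimately show "ip x y = (if x = y then 1 else 0)" using ee e1 ortho by auto
    qed
    ultimately show ?thesis
      using E eV by (intro exI[of _ "insert e E"] conjI) simp_all
  qed
qed

lemma ex_orthonormal_basis: "\<exists>E. orthonormal_basis E"
proof -
  obtain B where B: "finite B" "span B = V" using finite_generated by blast
  then have "B \<subseteq> V" using span_superset by blast
  obtain E where E: "finite E" "E \<subseteq> V"
    and ortho: "\<forall>e\<in>E. \<forall>e'\<in>E. ip e e' = (if e = e' then 1 else 0)" and BE: "B \<subseteq> span E"
    using orthonormal_span[OF B(1) \<open>B \<subseteq> V\<close>] by (elim exE conjE)
  have "V \<subseteq> span E" using BE B(2) span_minimal[OF BE] by auto
  have "s = (\<Sum>e\<in>E. sc (ip e s) e)" if s: "s \<in> V" for s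
  proof -
    obtain c where c: "s = (\<Sum>e\<in>E. sc (c e) e)"
      using \<open>V \<subseteq> span E\<close> s span_finite[OF E(1)] by auto
    have "ip e s = c e" if e: "e \<in> E" for e
    proof -
      have "ip e s = (\<Sum>e'\<in>E. c e' * ip e e')"
        unfolding c using e E(2) by (intro ip_sum) auto
      also have "\<dots> = (\<Sum>e'\<in>E. if e' = e then c e else 0)"
        using e by (intro sum.cong) (auto simp: ortho)
      also have "\<dots> = c e" using E(1) e by simp
      finally show ?thesis .
    qed
    then have "(\<Sum>e\<in>E. sc (ip e s) e) = (\<Sum>e\<in>E. sc (c e) e)" by (intro sum.cong) simp_all
    then show ?thesis using c by simp
  qed
  then show ?thesis using E ortho unfolding orthonormal_basis_def by (intro exI[of _ E]) blast
qed

text \<open>One orthonormal basis is chosen once and for all, so that traces, functionals and scalar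
  products are sums over the same set.\<close>

definition onb :: "'a set" where
  "onb = (SOME E. orthonormal_basis E)"

lemma onb: "orthonormal_basis onb"
  unfolding onb_def using ex_orthonormal_basis by (rule someI_ex)

lemma finite_onb: "finite onb" and onb_in_V: "e \<in> onb \<Longrightarrow> e \<in> V"
  and expand: "s \<in> V \<Longrightarrow> (\<Sum>e\<in>onb. sc (ip e s) e) = s"
  using onb unfolding orthonormal_basis_def by auto

lemma parseval:
  assumes "s \<in> V" "t \<in> V"
  shows "ip s t = (\<Sum>e\<in>onb. ip s e * ip e t)"
proof -
  have "ip s t = ip s (\<Sum>e\<in>onb. sc (ip e t) e)" using expand[OF assms(2)] by simp
  also have "\<dots> = (\<Sum>e\<in>onb. ip e t * ip s e)" using assms onb_in_V by (intro ip_sum) auto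
  finally show ?thesis by (simp add: mult.commute)
qed

lemma functional_expand:
  assumes add: "\<And>s t. s \<in> V \<Longrightarrow> t \<in> V \<Longrightarrow> \<phi> (s + t) = \<phi> s + (\<phi> t :: complex)"
    and scale: "\<And>a s. s \<in> V \<Longrightarrow> \<phi> (sc a s) = a * \<phi> s"
    and s: "s \<in> V"
  shows "\<phi> s = (\<Sum>e\<in>onb. ip e s * \<phi> e)"
proof -
  have 0: "\<phi> 0 = 0" using scale[of 0 0] V_intros(1) by simp
  have "\<phi> (\<Sum>e\<in>E. sc (ip e s) e) = (\<Sum>e\<in>E. ip e s * \<phi> e)" if "finite E" "E \<subseteq> V" for E
    using that
  proof (induction E rule: finite_induct)
    case (insert i I)
    have "(\<Sum>e\<in>I. sc (ip e s) e) \<in> V" using insert V_intros by (intro subspace_sum[OF subspace_V]) auto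
    then show ?case using insert V_intros(3) by (simp add: add scale)
  qed (simp add: 0)
  then show ?thesis using expand[OF s] finite_onb onb_in_V by (metis subsetI)
qed

text \<open>Conjugating the values of the functional on the orthonormal basis gives the coefficients of the
  representing vector; uniqueness is nondegeneracy.\<close>

lemma riesz:
  assumes add: "\<And>s t. s \<in> V \<Longrightarrow> t \<in> V \<Longrightarrow> \<phi> (s + t) = \<phi> s + (\<phi> t :: complex)"
    and scale: "\<And>a s. s \<in> V \<Longrightarrow> \<phi> (sc a s) = a * \<phi> s"
  shows "\<exists>!t. t \<in> V \<and> (\<forall>s\<in>V. ip t s = \<phi> s)"
proof (rule ex_ex1I)
  define t where "t = (\<Sum>e\<in>onb. sc (cnj (\<phi> e)) e)"
  have tV: "t \<in> V" unfolding t_def using onb_in_V by (intro subspace_sum[OF subspace_V] V_intros(3))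
  have "ip t s = \<phi> s" if s: "s \<in> V" for s
  proof -
    have "ip s t = (\<Sum>e\<in>onb. cnj (\<phi> e) * ip s e)"
      unfolding t_def using s onb_in_V by (intro ip_sum)
    then have "ip t s = (\<Sum>e\<in>onb. \<phi> e * ip e s)"
      using ip_cnj[OF s tV] ip_cnj[OF s onb_in_V] by simp
    then show ?thesis using functional_expand[of \<phi>, OF add scale s] by (simp add: mult.commute)
  qed
  then show "\<exists>t. t \<in> V \<and> (\<forall>s\<in>V. ip t s = \<phi> s)" using tV by blast
next
  fix t t' assume "t \<in> V \<and> (\<forall>s\<in>V. ip t s = \<phi> s)" "t' \<in> V \<and> (\<forall>s\<in>V. ip t' s = \<phi> s)"
  then show "t = t'" by (intro ip_eqI) (auto simp: ip_cnj[of t] ip_cnj[of t'])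
qed

lemma basis_finite: "basis_of sc V B \<Longrightarrow> finite B"
  using finite_generated independent_span_bound[of _ B] span_superset
  unfolding basis_of_def by metis

lemma ex_basis: "\<exists>B. basis_of sc V B"
  using maximal_independent_subset[of V] span_subspace[OF _ _ subspace_V]
  unfolding basis_of_def by metis

text \<open>\<^const>\<open>trace_on\<close> is computed in an arbitrary basis \<open>B\<close>. Expanding its coordinate functionals
  in the orthonormal basis gives the double sum of \<open>\<langle>e, A b\<rangle>\<close> times the \<open>b\<close>-coordinate of \<open>e\<close>, and summing
  over \<open>b\<close> first reassembles \<open>A e\<close>.\<close>

lemma trace_eq:
  assumes A: "A \<in> endo sc V"
  shows "trace_on sc V A = (\<Sum>e\<in>onb. ip e (A e))"
proof -
  define B where "B = (SOME B. basis_of sc V B)"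
  have B: "basis_of sc V B" unfolding B_def using ex_basis by (rule someI_ex)
  then have ind: "independent B" and sp: "span B = V" and fin: "finite B"
    using basis_finite by (auto simp: basis_of_def)
  have BV: "b \<in> V" if "b \<in> B" for b using that span_base[of b B] sp by auto
  have AV: "A s \<in> V" if "s \<in> V" for s using A that by (simp add: endo_def)
  have rep: "representation B (A b) b = (\<Sum>e\<in>onb. ip e (A b) * representation B e b)" if "b \<in> B" for b
    using BV[OF that]
    by (intro functional_expand[of "\<lambda>s. representation B s b"] AV)
       (auto simp: representation_add[OF ind] representation_scale[OF ind] sp)
  have coeff: "(\<Sum>b\<in>B. representation B e b * ip e (A b)) = ip e (A e)" if e: "e \<in> onb" for e
  proof -
    have eV: "e \<in> V" using e by (rule onb_in_V)
    have lin: "A (\<Sum>b\<in>C. sc (c b) b) = (\<Sum>b\<in>C. sc (c b) (A b))" if "finite C" "C \<subseteq> V" for C c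
      using that
    proof (induction C rule: finite_induct)
      case empty
      have "A (sc 0 0) = sc 0 (A 0)" using A V_intros(1) unfolding endo_def by blast
      then show ?case by simp
    next
      case (insert b C)
      have "(\<Sum>b\<in>C. sc (c b) b) \<in> V" using insert V_intros by (intro subspace_sum[OF subspace_V]) auto
      then show ?case using insert V_intros(3) A by (simp add: endo_def)
    qed
    have "e = (\<Sum>b\<in>B. sc (representation B e b) b)"
      using sum_representation_eq[OF ind, of e B] sp eV fin by auto
    then have "A e = (\<Sum>b\<in>B. sc (representation B e b) (A b))"
      using lin[OF fin, of "representation B e"] BV by auto
    then show ?thesis using ip_sum[of e B A "representation B e"] eV AV BV by simp
  qed
  have "trace_on sc V A = (\<Sum>b\<in>B. \<Sum>e\<in>onb. ip e (A b) * representation B e b)"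
    unfolding trace_on_def Let_def B_def[symmetric] by (intro sum.cong refl rep)
  also have "\<dots> = (\<Sum>e\<in>onb. \<Sum>b\<in>B. representation B e b * ip e (A b))"
    by (subst sum.swap) (simp add: mult.commute)
  also have "\<dots> = (\<Sum>e\<in>onb. ip e (A e))" by (intro sum.cong refl coeff)
  finally show ?thesis .
qed

end

section \<open>The volume of a compact Kaehler manifold\<close>

lemma smooth_on_imp_continuous_on: "smooth_on S f \<Longrightarrow> continuous_on S f"
  unfolding smooth_on_def using Ck_on.simps(1) by blast

lemma hol_on_imp_continuous_on:
  assumes "hol_on S f"
  shows "continuous_on S f"
proof -
  have "isCont f z" if z: "z \<in> S" for z
  proof -
    obtain f' where "(f has_derivative f') (at z)"
      using bspec[OF assms[unfolded hol_on_def] z] by (elim exE conjE)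
    then show ?thesis by (rule has_derivative_continuous)
  qed
  then show ?thesis by (simp add: continuous_at_imp_continuous_on)
qed

lemma local_expr_apply:
  assumes "complex_atlas \<A>" "c \<in> \<A>" "x \<in> fst c"
  shows "local_expr c f (snd c x) = f x"
proof -
  have "homeomorphism (fst c) (snd c ` fst c) (snd c) (the_inv_into (fst c) (snd c))"
    using assms unfolding complex_atlas_def by blast
  from homeomorphism_apply1[OF this assms(3)] show ?thesis by (simp add: local_expr_def)
qed

lemma continuous_on_from_charts:
  fixes f :: "'m::t2_space \<Rightarrow> 'b::topological_space" and \<A> :: "('m, 'n::finite) chart set"
  assumes \<A>: "complex_atlas \<A>" and "open W"
    and f: "\<And>c. c \<in> \<A> \<Longrightarrow> continuous_on (snd c ` (W \<inter> fst c)) (local_expr c f)"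
  shows "continuous_on W f"
proof -
  have "continuous_on (W \<inter> fst c) f" if c: "c \<in> \<A>" for c
  proof -
    have "continuous_on (fst c) (snd c)"
      using \<A> c unfolding complex_atlas_def homeomorphism_def by blast
    then have "continuous_on (W \<inter> fst c) (local_expr c f \<circ> snd c)"
      by (intro continuous_on_compose f[OF c]) (auto elim: continuous_on_subset)
    then show ?thesis
      by (rule continuous_on_eq) (simp add: local_expr_apply[OF \<A> c])
  qed
  moreover have "open (W \<inter> fst c)" if "c \<in> \<A>" for c
    using \<A> that \<open>open W\<close> unfolding complex_atlas_def by blast
  ultimately have "continuous_on (\<Union>c\<in>\<A>. W \<inter> fst c) f"
    by (intro continuous_on_open_UN) auto
  moreover have "(\<Union>c\<in>\<A>. W \<inter> fst c) = W"
    using \<A> unfolding complex_atlas_def by blast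
  ultimately show ?thesis by simp
qed

lemma smooth_fun_on_imp_continuous_on:
  "complex_atlas \<A> \<Longrightarrow> open W \<Longrightarrow> smooth_fun_on \<A> W f \<Longrightarrow> continuous_on W f"
  by (rule continuous_on_from_charts)
     (auto simp: smooth_fun_on_def intro: smooth_on_imp_continuous_on)

lemma hol_fun_on_imp_continuous_on:
  "complex_atlas \<A> \<Longrightarrow> open W \<Longrightarrow> hol_fun_on \<A> W f \<Longrightarrow> continuous_on W f"
  by (rule continuous_on_from_charts)
     (auto simp: hol_fun_on_def intro: hol_on_imp_continuous_on)

lemma kaehler_positive_form:
  assumes "kaehler_form \<A> \<omega>" "c \<in> \<A>" "x \<in> fst c"
  shows "positive_form (\<omega> c x)"
  using assms unfolding kaehler_form_def smooth_form2_def by unfold_locales blast+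

lemma continuous_on_volume_density:
  assumes "kaehler_form \<A> \<omega>" "c \<in> \<A>"
  shows "continuous_on (snd c ` fst c) (local_expr c (\<lambda>x. top_power (\<omega> c x) / fact CARD('n)))"
proof -
  have "continuous_on (snd c ` fst c) (\<lambda>z. local_expr c (\<lambda>x. \<omega> c x u v) z)" for u v
    using assms unfolding kaehler_form_def smooth_form2_def
    by (intro smooth_on_imp_continuous_on) blast
  then show ?thesis
    unfolding local_expr_def comp_def top_power_def by (intro continuous_intros) auto
qed

text \<open>In a chart the density of the volume is continuous, and positive at \<open>x\<close> because \<open>\<omega>\<close> is a
  positive form there. On a small coordinate ball it therefore lies between two positive constants,
  and the volume of the ball is comparable to its Lebesgue measure.\<close>

lemma volume_nbhd:
  fixes \<A> :: "('m::t2_space, 'n::finite) chart set"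
  assumes \<A>: "complex_atlas \<A>" and \<omega>: "kaehler_form \<A> \<omega>" and \<mu>: "volume_measure \<A> \<omega> \<mu>"
    and "open U" "x \<in> U"
  shows "\<exists>N. open N \<and> x \<in> N \<and> N \<subseteq> U \<and> 0 < emeasure \<mu> N \<and> emeasure \<mu> N < \<infinity>"
proof -
  obtain c where c: "c \<in> \<A>" "x \<in> fst c" using \<A> unfolding complex_atlas_def by blast
  let ?T = "snd c ` fst c" and ?g = "the_inv_into (fst c) (snd c)"
  have hom: "homeomorphism (fst c) ?T (snd c) ?g" and oc: "open (fst c)" and oT: "open ?T"
    using \<A> c(1) unfolding complex_atlas_def by blast+
  have cg: "continuous_on ?T ?g" and cs: "continuous_on (fst c) (snd c)"
    using hom unfolding homeomorphism_def by blast+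
  define D where "D = local_expr c (\<lambda>x. top_power (\<omega> c x) / fact CARD('n))"
  have cD: "continuous_on ?T D"
    unfolding D_def by (rule continuous_on_volume_density[OF \<omega> c(1)])
  define d where "d = D (snd c x)"
  have "d = top_power (\<omega> c x) / fact CARD('n)"
    unfolding d_def D_def by (rule local_expr_apply[OF \<A> c])
  then have d: "d > 0"
    using positive_form.top_power_pos[OF kaehler_positive_form[OF \<omega> c]] by simp
  let ?O = "(?T \<inter> ?g -` U) \<inter> (?T \<inter> D -` {d/2<..<2*d})"
  have "open ?O"
    using cg cD oT \<open>open U\<close> by (intro open_Int continuous_open_preimage) auto
  moreover have "snd c x \<in> ?O"
    using c(2) d \<open>x \<in> U\<close> homeomorphism_apply1[OF hom c(2)] by (auto simp: d_def)
  ultimately obtain r where r: "r > 0" "ball (snd c x) r \<subseteq> ?O"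
    by (meson open_contains_ball)
  let ?B = "ball (snd c x) r"
  define N where "N = fst c \<inter> snd c -` ?B"
  have oN: "open N" unfolding N_def by (intro continuous_open_preimage cs oc) auto
  have xN: "x \<in> N" using c(2) r(1) by (simp add: N_def)
  have NU: "N \<subseteq> U"
  proof
    fix y assume "y \<in> N"
    then have y: "y \<in> fst c" "snd c y \<in> ?O" using r(2) by (auto simp: N_def)
    then show "y \<in> U" using homeomorphism_apply1[OF hom y(1)] by simp
  qed
  have image: "snd c ` N = ?B"
    using r(2) unfolding N_def by blast
  have N: "emeasure \<mu> N = (\<integral>\<^sup>+z. ennreal (D z) * indicator ?B z \<partial>lborel)"
  proof -
    have "N \<in> sets borel" "N \<subseteq> fst c" using oN by (auto simp: N_def)
    then show ?thesis using \<mu> c(1) unfolding volume_measure_def D_def image[symmetric] by blast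
  qed
  have bounds: "d / 2 \<le> D z" "D z \<le> 2 * d" if "z \<in> ?B" for z
    using that r(2) by fastforce+
  have "emeasure \<mu> N \<le> (\<integral>\<^sup>+z. ennreal (2 * d) * indicator ?B z \<partial>lborel)"
    unfolding N by (intro nn_integral_mono) (auto split: split_indicator intro!: ennreal_leI bounds(2))
  also have "\<dots> = ennreal (2 * d) * emeasure lborel ?B"
    by (simp add: nn_integral_cmult_indicator)
  also have "\<dots> < \<infinity>"
    using emeasure_lborel_ball_finite[of "snd c x" r] by (simp add: ennreal_mult_less_top)
  finally have upper: "emeasure \<mu> N < \<infinity>" .
  have "emeasure lborel ?B > 0"
    using content_ball_pos[OF r(1), of "snd c x"] emeasure_lborel_ball_finite[of "snd c x" r]
    by (simp add: measure_def enn2real_positive_iff)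
  then have "0 < ennreal (d / 2) * emeasure lborel ?B" using d by (simp add: ennreal_zero_less_mult_iff)
  also have "\<dots> = (\<integral>\<^sup>+z. ennreal (d / 2) * indicator ?B z \<partial>lborel)"
    by (simp add: nn_integral_cmult_indicator)
  also have "\<dots> \<le> emeasure \<mu> N"
    unfolding N by (intro nn_integral_mono) (auto split: split_indicator intro!: ennreal_leI bounds(1))
  finally show ?thesis using oN xN NU upper by blast
qed

lemma finite_volume:
  fixes \<A> :: "('m::t2_space, 'n::finite) chart set"
  assumes M: "compact_kaehler_manifold \<A> \<omega>" and \<mu>: "volume_measure \<A> \<omega> \<mu>"
  shows "finite_measure \<mu>"
proof
  have \<A>: "complex_atlas \<A>" and \<omega>: "kaehler_form \<A> \<omega>" and cpt: "compact (UNIV :: 'm set)"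
    using M unfolding compact_kaehler_manifold_def by auto
  have sets: "sets \<mu> = sets borel" using \<mu> unfolding volume_measure_def by blast
  then have space: "space \<mu> = UNIV" using sets_eq_imp_space_eq[of \<mu> borel] by simp
  have "\<forall>x. \<exists>N. open N \<and> x \<in> N \<and> emeasure \<mu> N < \<infinity>"
    using volume_nbhd[OF \<A> \<omega> \<mu> open_UNIV UNIV_I] by blast
  then obtain N where N: "\<And>x. open (N x)" "\<And>x. x \<in> N x" "\<And>x. emeasure \<mu> (N x) < \<infinity>"
    by metis
  obtain K where K: "finite K" "UNIV \<subseteq> (\<Union>x\<in>K. N x)"
  proof (rule compactE_image[OF cpt, of UNIV N])
    show "UNIV \<subseteq> (\<Union>x\<in>UNIV. N x)" using N(2) by blast
  qed (use N(1) in simp_all)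
  have "emeasure \<mu> UNIV \<le> emeasure \<mu> (\<Union>x\<in>K. N x)"
    using K N(1) sets by (intro emeasure_mono) auto
  also have "\<dots> \<le> (\<Sum>x\<in>K. emeasure \<mu> (N x))"
    using K N(1) sets by (intro emeasure_subadditive_finite) auto
  also have "\<dots> < \<infinity>" using N(3) by (simp add: ennreal_sum_less_top K(1))
  finally show "emeasure \<mu> (space \<mu>) \<noteq> \<infinity>" by (simp add: space)
qed

section \<open>Continuous sections and their scalar product\<close>

locale quantised_manifold =
  fixes \<A> :: "('m::t2_space, 'n::finite) chart set"
    and \<omega> :: "('m, 'n) form2"
    and L :: "('m, 'v::ab_group_add) line_bundle"
    and h :: "'m \<Rightarrow> 'v \<Rightarrow> 'v \<Rightarrow> complex"
    and \<mu> :: "'m measure"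
  assumes manifold: "compact_kaehler_manifold \<A> \<omega>"
    and hol_bundle: "hol_line_bundle \<A> L"
    and metric: "hermitian_metric \<A> L h"
    and ample: "very_ample \<A> L"
    and volume: "volume_measure \<A> \<omega> \<mu>"
begin

lemma atlas: "complex_atlas \<A>" and compact_UNIV: "compact (UNIV :: 'm set)"
  and kaehler: "kaehler_form \<A> \<omega>"
  using manifold unfolding compact_kaehler_manifold_def by auto

lemma sets_mu: "sets \<mu> = sets borel"
  using volume unfolding volume_measure_def by blast

sublocale finite_measure \<mu>
  by (rule finite_volume[OF manifold volume])

sublocale V: vector_space "scl L"
  using hol_bundle unfolding hol_line_bundle_def by blast

sublocale S: vector_space "sec_scl L"
  by unfold_locales
     (auto simp: fun_scl_def fun_eq_iff V.scale_right_distrib V.scale_left_distrib)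

abbreviation \<H> :: "('m \<Rightarrow> 'v) set" where "\<H> \<equiv> hol_sections \<A> L"

abbreviation sp :: "('m \<Rightarrow> 'v) \<Rightarrow> ('m \<Rightarrow> 'v) \<Rightarrow> complex" (\<open>\<langle>_, _\<rangle>\<close>)
  where "\<langle>s, t\<rangle> \<equiv> sprod h \<mu> s t"

lemma fibres: "\<forall>x. V.subspace (fibre L x) \<and> V.dim (fibre L x) = 1"
  and cover: "(\<Union>(U, e)\<in>frames L. U) = UNIV"
  and frames_nonzero: "\<forall>(U, e)\<in>frames L. open U \<and> (\<forall>x\<in>U. e x \<in> fibre L x \<and> e x \<noteq> 0)"
  using hol_bundle unfolding hol_line_bundle_def by - (elim conjE, assumption)+

lemma fibre_subspace: "V.subspace (fibre L x)"
  using fibres by simp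

lemmas fibre_intros = V.subspace_0[OF fibre_subspace] V.subspace_add[OF fibre_subspace]
  V.subspace_diff[OF fibre_subspace] V.subspace_scale[OF fibre_subspace]

lemma quot_scale_self: "q \<noteq> 0 \<Longrightarrow> quot L q (scl L a q) = a"
  unfolding quot_def by (rule the_equality) (auto simp: V.scale_cancel_right)

text \<open>As fibres are one-dimensional, the description in \<^const>\<open>quot\<close> has a solution, and \<open>quot L q\<close>
  is the linear coordinate on the fibre given by \<open>q\<close>.\<close>

lemma fibre_line:
  assumes "q \<in> fibre L x" "q \<noteq> 0" "v \<in> fibre L x"
  shows "scl L (quot L q v) q = v"
proof -
  obtain B where "fibre L x \<subseteq> V.span B" "card B = V.dim (fibre L x)"
    by (rule V.basis_exists[of "fibre L x"])
  moreover have "V.dim (fibre L x) = 1" using fibres by simp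
  ultimately have "card B = 1" "fibre L x \<subseteq> V.span B" by simp_all
  then obtain b where "fibre L x \<subseteq> V.span {b}" using card_1_singletonE[of B] by metis
  then obtain c d where c: "v = scl L c b" and d: "q = scl L d b"
    using assms unfolding V.span_singleton by (meson rangeE subsetD)
  then have "v = scl L (c / d) q" using assms(2) by auto
  then show ?thesis using quot_scale_self[OF assms(2)] by metis
qed

lemma quot_add:
  assumes "q \<in> fibre L x" "q \<noteq> 0" "u \<in> fibre L x" "v \<in> fibre L x"
  shows "quot L q (u + v) = quot L q u + quot L q v"
proof -
  have "u + v = scl L (quot L q u + quot L q v) q"
    using fibre_line[OF assms(1,2,3)] fibre_line[OF assms(1,2,4)] by (simp add: V.scale_left_distrib)
  then show ?thesis using quot_scale_self[OF assms(2)] by simp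
qed

lemma quot_scale:
  assumes "q \<in> fibre L x" "q \<noteq> 0" "v \<in> fibre L x"
  shows "quot L q (scl L a v) = a * quot L q v"
proof -
  have "scl L a v = scl L (a * quot L q v) q"
    using fibre_line[OF assms] by (metis V.scale_scale)
  then show ?thesis using quot_scale_self[OF assms(2)] by simp
qed

lemma metric_fibre: "\<forall>x. \<forall>u\<in>fibre L x. \<forall>v\<in>fibre L x.
        (\<forall>w\<in>fibre L x. h x u (v + w) = h x u v + h x u w) \<and>
        (\<forall>a. h x u (scl L a v) = a * h x u v) \<and>
        h x v u = cnj (h x u v) \<and>
        (u \<noteq> 0 \<longrightarrow> Re (h x u u) > 0)"
  and metric_smooth: "\<forall>(U, e)\<in>frames L. smooth_fun_on \<A> U (\<lambda>x. h x (e x) (e x))"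
  using metric unfolding hermitian_metric_def by - (elim conjE, assumption)+

lemma
  assumes u: "u \<in> fibre L x" and v: "v \<in> fibre L x"
  shows h_add: "w \<in> fibre L x \<Longrightarrow> h x u (v + w) = h x u v + h x u w"
    and h_scale: "h x u (scl L a v) = a * h x u v"
    and h_cnj: "h x v u = cnj (h x u v)"
  using bspec[OF bspec[OF spec[OF metric_fibre] u] v] by blast+

lemma h_pos:
  assumes u: "u \<in> fibre L x" and "u \<noteq> 0"
  shows "Re (h x u u) > 0"
  using bspec[OF bspec[OF spec[OF metric_fibre] u] u] assms(2) by blast

lemma h_self_real: "u \<in> fibre L x \<Longrightarrow> of_real (Re (h x u u)) = h x u u"
  using h_cnj[of u x u] by (simp add: complex_eq_iff)

lemma h_frame:
  assumes "q \<in> fibre L x" "q \<noteq> 0" "u \<in> fibre L x" "v \<in> fibre L x"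
  shows "h x u v = cnj (quot L q u) * quot L q v * h x q q"
proof -
  have "h x u v = quot L q v * h x u q"
    using h_scale[OF assms(3,1), of "quot L q v"] fibre_line[OF assms(1,2,4)] by simp
  also have "h x u q = cnj (h x q u)" by (rule h_cnj[OF assms(1,3)])
  also have "h x q u = quot L q u * h x q q"
    using h_scale[OF assms(1,1), of "quot L q u"] fibre_line[OF assms(1,2,3)] by simp
  finally show ?thesis using h_cnj[OF assms(1,1)] by simp
qed

text \<open>This space contains the holomorphic sections \<open>s\<close> and their products \<open>f s\<close> with
  continuous functions. By compactness all scalar products of its members are convergent integrals,
  which makes \<^const>\<open>sprod\<close> sesquilinear on it.\<close>

definition continuous_sections :: "('m \<Rightarrow> 'v) set" where
  "continuous_sections =
     {s \<in> sections L. \<forall>(U, e)\<in>frames L. continuous_on U (\<lambda>x. quot L (e x) (s x))}"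

lemma continuous_in_fibre: "s \<in> continuous_sections \<Longrightarrow> s x \<in> fibre L x"
  by (simp add: continuous_sections_def sections_def)

lemma frame:
  assumes "(U, e) \<in> frames L"
  shows "open U" "x \<in> U \<Longrightarrow> e x \<in> fibre L x" "x \<in> U \<Longrightarrow> e x \<noteq> 0"
  using bspec[OF frames_nonzero assms] by auto

lemma hol_continuous:
  assumes "s \<in> \<H>"
  shows "s \<in> continuous_sections"
proof -
  have s: "s \<in> sections L" "\<forall>(U, e)\<in>frames L. hol_fun_on \<A> (U \<inter> UNIV) (\<lambda>x. quot L (e x) (s x))"
    using assms unfolding hol_sections_def hol_section_on_def by simp_all
  have "continuous_on U (\<lambda>x. quot L (e x) (s x))" if f: "(U, e) \<in> frames L" for U e
    using bspec[OF s(2) f] by (intro hol_fun_on_imp_continuous_on[OF atlas frame(1)[OF f]]) simp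
  then show ?thesis using s(1) by (auto simp: continuous_sections_def)
qed

lemma continuous_sections_add:
  assumes "s \<in> continuous_sections" "t \<in> continuous_sections"
  shows "s + t \<in> continuous_sections"
proof -
  have "continuous_on U (\<lambda>x. quot L (e x) ((s + t) x))" if f: "(U, e) \<in> frames L" for U e
  proof -
    have "continuous_on U (\<lambda>x. quot L (e x) (s x) + quot L (e x) (t x))"
      using assms f unfolding continuous_sections_def by (intro continuous_intros) auto
    then show ?thesis
      by (rule continuous_on_eq)
         (simp add: quot_add[OF frame(2,3)[OF f]] continuous_in_fibre assms)
  qed
  moreover have "s + t \<in> sections L"
    using assms continuous_in_fibre fibre_intros by (auto simp: sections_def)
  ultimately show ?thesis by (auto simp: continuous_sections_def)
qed

lemma continuous_sections_fun_scl:
  assumes "s \<in> continuous_sections" "continuous_on UNIV f"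
  shows "fun_scl L f s \<in> continuous_sections"
proof -
  have "continuous_on U (\<lambda>x. quot L (e x) (fun_scl L f s x))" if f: "(U, e) \<in> frames L" for U e
  proof -
    have "continuous_on U (\<lambda>x. f x * quot L (e x) (s x))"
      using assms f continuous_on_subset[OF assms(2), of U] unfolding continuous_sections_def
      by (intro continuous_intros) auto
    then show ?thesis
      by (rule continuous_on_eq)
         (simp add: fun_scl_def quot_scale[OF frame(2,3)[OF f]] continuous_in_fibre assms)
  qed
  moreover have "fun_scl L f s \<in> sections L"
    using assms continuous_in_fibre fibre_intros by (auto simp: sections_def fun_scl_def)
  ultimately show ?thesis by (auto simp: continuous_sections_def)
qed

lemma continuous_sections_diff:
  assumes "s \<in> continuous_sections" "t \<in> continuous_sections"
  shows "s - t \<in> continuous_sections"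
proof -
  have "s - t = s + sec_scl L (- 1) t" by (auto simp: fun_scl_def)
  then show ?thesis
    using continuous_sections_add[OF assms(1) continuous_sections_fun_scl[OF assms(2) continuous_on_const[of _ "- 1"]]]
    by simp
qed

lemma continuous_h:
  assumes s: "s \<in> continuous_sections" and t: "t \<in> continuous_sections"
  shows "continuous_on UNIV (\<lambda>x. h x (s x) (t x))"
proof -
  have "continuous_on U (\<lambda>x. h x (s x) (t x))" if f: "(U, e) \<in> frames L" for U e
  proof -
    have "continuous_on U (\<lambda>x. h x (e x) (e x))"
      using bspec[OF metric_smooth f]
      by (intro smooth_fun_on_imp_continuous_on[OF atlas frame(1)[OF f]]) simp
    moreover have "continuous_on U (\<lambda>x. quot L (e x) (s x))" "continuous_on U (\<lambda>x. quot L (e x) (t x))"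
      using s t f unfolding continuous_sections_def by auto
    ultimately have "continuous_on U (\<lambda>x. cnj (quot L (e x) (s x)) * quot L (e x) (t x) * h x (e x) (e x))"
      by (intro continuous_intros)
    then show ?thesis
      by (rule continuous_on_eq)
         (rule h_frame[OF frame(2,3)[OF f] continuous_in_fibre continuous_in_fibre, OF _ _ s t, symmetric])
  qed
  then have "continuous_on (\<Union>(U, e)\<in>frames L. U) (\<lambda>x. h x (s x) (t x))"
    using frame(1) by (intro continuous_on_open_UN) auto
  then show ?thesis by (simp only: cover)
qed

lemma continuous_measurable:
  fixes f :: "'m \<Rightarrow> 'b::topological_space"
  shows "continuous_on UNIV f \<Longrightarrow> f \<in> borel_measurable \<mu>"
  using borel_measurable_continuous_onI measurable_cong_sets[OF sets_mu refl] by blast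

lemma continuous_integrable:
  fixes f :: "'m \<Rightarrow> complex"
  assumes "continuous_on UNIV f"
  shows "integrable \<mu> f"
proof -
  have "bounded (range f)"
    using compact_continuous_image[OF assms compact_UNIV] by (rule compact_imp_bounded)
  then obtain B where "\<And>x. norm (f x) \<le> B" unfolding bounded_iff by blast
  then show ?thesis
    by (intro integrable_const_bound[of _ B] continuous_measurable assms) auto
qed

lemma sprod_add:
  assumes "s \<in> continuous_sections" "t \<in> continuous_sections" "u \<in> continuous_sections"
  shows "\<langle>s, t + u\<rangle> = \<langle>s, t\<rangle> + \<langle>s, u\<rangle>"
  unfolding sprod_def using assms
  by (simp add: h_add continuous_in_fibre continuous_integrable continuous_h)

lemma sprod_scale:
  assumes "s \<in> continuous_sections" "t \<in> continuous_sections"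
  shows "\<langle>s, sec_scl L a t\<rangle> = a * \<langle>s, t\<rangle>"
  unfolding sprod_def fun_scl_def using assms by (simp add: h_scale continuous_in_fibre)

lemma sprod_cnj:
  assumes "s \<in> continuous_sections" "t \<in> continuous_sections"
  shows "\<langle>t, s\<rangle> = cnj \<langle>s, t\<rangle>"
proof -
  have "\<langle>t, s\<rangle> = (\<integral>x. cnj (h x (s x) (t x)) \<partial>\<mu>)"
    unfolding sprod_def by (intro Bochner_Integration.integral_cong refl h_cnj continuous_in_fibre assms)
  then show ?thesis by (simp add: sprod_def)
qed

text \<open>If the integral of the nonnegative function \<open>h(s, s)\<close> were zero, the set where it is positive
  would be null; but this set is open and nonempty and so contains an open set of positive volume.\<close>

lemma sprod_pos:
  assumes s: "s \<in> continuous_sections" and "s \<noteq> 0"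
  shows "Re \<langle>s, s\<rangle> > 0"
proof -
  let ?g = "\<lambda>x. Re (h x (s x) (s x))"
  have int: "integrable \<mu> ?g" by (intro integrable_Re continuous_integrable continuous_h s)
  have nonneg: "?g x \<ge> 0" for x
  proof (cases "s x = 0")
    case True
    then show ?thesis using h_scale[of 0 x 0 0] fibre_intros(1) by simp
  next
    case False
    then show ?thesis using h_pos[OF continuous_in_fibre[OF s]] by (simp add: less_imp_le)
  qed
  have eq: "Re \<langle>s, s\<rangle> = integral\<^sup>L \<mu> ?g"
    unfolding sprod_def by (intro integral_Re[symmetric] continuous_integrable continuous_h s)
  have "integral\<^sup>L \<mu> ?g \<noteq> 0"
  proof
    assume "integral\<^sup>L \<mu> ?g = 0"
    then have ae: "AE x in \<mu>. ?g x = 0" using integral_nonneg_eq_0_iff_AE[OF int] nonneg by simp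
    let ?U = "?g -` {0<..}"
    have "open ?U" by (intro open_vimage continuous_intros continuous_h s)
    moreover obtain x where "s x \<noteq> 0" using \<open>s \<noteq> 0\<close> by (auto simp: fun_eq_iff)
    then have "x \<in> ?U" using h_pos[OF continuous_in_fibre[OF s]] by simp
    ultimately obtain N where N: "open N" "N \<subseteq> ?U" "0 < emeasure \<mu> N"
      using volume_nbhd[OF atlas kaehler volume] by blast
    have "AE x in \<mu>. x \<notin> N" using ae by eventually_elim (use N(2) in auto)
    then have "emeasure \<mu> N = 0"
      using N(1) by (subst (asm) AE_iff_measurable[of N]) (auto simp: sets_mu sets_eq_imp_space_eq[OF sets_mu])
    then show False using N(3) by simp
  qed
  moreover have "integral\<^sup>L \<mu> ?g \<ge> 0" using nonneg by (rule Bochner_Integration.integral_nonneg)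
  ultimately show ?thesis unfolding eq by linarith
qed

section \<open>Coherent vectors and the covariant symbol\<close>

text \<open>Very ampleness provides both the finite dimension of the space of holomorphic sections and the
  absence of base points, by which coherent vectors are nonzero and \<open>\<epsilon>\<close> is positive.\<close>

lemma ex_base: "\<exists>B. finite B \<and> basis_of (sec_scl L) \<H> B \<and> (\<forall>x. \<exists>s\<in>B. s x \<noteq> 0)"
  using ample unfolding very_ample_def by (elim exE conjE) (intro exI conjI)

sublocale H: hermitian_space "sec_scl L" \<H> "sprod h \<mu>"
proof
  show "\<exists>B. finite B \<and> S.span B = \<H>" using ex_base by (auto simp: basis_of_def)
qed (simp_all add: sprod_add sprod_scale sprod_cnj[symmetric] sprod_pos hol_continuous)

lemma base_point_free: "\<exists>s\<in>\<H>. s x \<noteq> 0"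
proof -
  obtain B where B: "S.span B = \<H>" and free: "\<forall>x. \<exists>s\<in>B. s x \<noteq> 0"
    using ex_base unfolding basis_of_def by (elim exE conjE)
  obtain s where "s \<in> B" "s x \<noteq> 0" using free by auto
  then show ?thesis using S.span_base[of s B] unfolding B by (intro bexI[of _ s])
qed

lemma q_hat_add: "q \<in> punctured L \<Longrightarrow> s \<in> \<H> \<Longrightarrow> t \<in> \<H> \<Longrightarrow> q_hat L q (s + t) = q_hat L q s + q_hat L q t"
  by (auto simp: q_hat_def punctured_def quot_add continuous_in_fibre hol_continuous)

lemma q_hat_scale: "q \<in> punctured L \<Longrightarrow> s \<in> \<H> \<Longrightarrow> q_hat L q (sec_scl L a s) = a * q_hat L q s"
  by (auto simp: q_hat_def punctured_def fun_scl_def quot_scale continuous_in_fibre hol_continuous)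

text \<open>Riesz representation of the evaluation functional at \<open>q\<close>.\<close>

lemma coherent_reproduces:
  assumes "q \<in> punctured L"
  shows "coherent \<A> L h \<mu> q \<in> \<H>" "s \<in> \<H> \<Longrightarrow> \<langle>coherent \<A> L h \<mu> q, s\<rangle> = q_hat L q s"
proof -
  have "\<exists>!e. e \<in> \<H> \<and> (\<forall>s\<in>\<H>. \<langle>e, s\<rangle> = q_hat L q s)"
    by (intro H.riesz q_hat_add q_hat_scale assms)
  from theI'[OF this] have *: "coherent \<A> L h \<mu> q \<in> \<H> \<and> (\<forall>s\<in>\<H>. \<langle>coherent \<A> L h \<mu> q, s\<rangle> = q_hat L q s)"
    unfolding coherent_def .
  show "coherent \<A> L h \<mu> q \<in> \<H>" "s \<in> \<H> \<Longrightarrow> \<langle>coherent \<A> L h \<mu> q, s\<rangle> = q_hat L q s"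
    using * by simp_all
qed

lemma coherent_nonzero:
  assumes "q \<in> punctured L"
  shows "\<langle>coherent \<A> L h \<mu> q, coherent \<A> L h \<mu> q\<rangle> \<noteq> 0"
proof
  let ?e = "coherent \<A> L h \<mu> q"
  assume "\<langle>?e, ?e\<rangle> = 0"
  then have 0: "?e = 0" using H.ip_self_eq_0 coherent_reproduces(1)[OF assms] by blast
  obtain s where s: "s \<in> \<H>" "s (fst q) \<noteq> 0" using base_point_free by blast
  have "\<langle>?e, s\<rangle> = 0"
    using 0 H.ip_zero[OF s(1)] H.ip_cnj[OF s(1) H.V_intros(1)] by simp
  then have "q_hat L q s = 0" using coherent_reproduces(2)[OF assms s(1)] by simp
  moreover have "scl L (q_hat L q s) (snd q) = s (fst q)"
    using assms continuous_in_fibre[OF hol_continuous[OF s(1)]]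
    unfolding q_hat_def by (intro fibre_line[of _ "fst q"]) (auto simp: punctured_def)
  ultimately show False using s(2) by simp
qed

lemma point_over: "point_over L x \<in> punctured L" "fst (point_over L x) = x"
proof -
  obtain s where "s \<in> \<H>" "s x \<noteq> 0" using base_point_free by blast
  then have "(x, s x) \<in> punctured L \<and> fst (x, s x) = x"
    by (auto simp: punctured_def continuous_in_fibre hol_continuous)
  then have "point_over L x \<in> punctured L \<and> fst (point_over L x) = x"
    unfolding point_over_def by (rule someI)
  then show "point_over L x \<in> punctured L" "fst (point_over L x) = x" by auto
qed

text \<open>The factor \<open>|q|\<^sup>2\<close> turns products of the coordinates with respect to \<open>q\<close> into hermitian
  products of the values, which no longer depend on \<open>q\<close>.\<close>

lemma h_q_hat:
  assumes "s \<in> \<H>" "t \<in> \<H>"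
  shows "of_real (Re (h x (snd (point_over L x)) (snd (point_over L x))))
      * (cnj (q_hat L (point_over L x) s) * q_hat L (point_over L x) t) = h x (s x) (t x)"
proof -
  obtain v where v: "point_over L x = (x, v)" using point_over(2) by (metis surjective_pairing)
  then have "v \<in> fibre L x" "v \<noteq> 0" using point_over(1)[of x] by (auto simp: punctured_def)
  then show ?thesis
    using assms h_frame[of v x "s x" "t x"]
    by (simp add: v q_hat_def h_self_real continuous_in_fibre hol_continuous mult.commute)
qed

text \<open>The coefficient of the coherent vector at a basis vector \<open>b\<close> is \<open>\<langle>b, e\<^sub>q\<rangle>\<close>, the conjugate of
  \<open>\<langle>e\<^sub>q, b\<rangle> = q_hat b\<close>.\<close>

lemma functional_coherent:
  assumes q: "q \<in> punctured L" and A: "A \<in> endo (sec_scl L) \<H>"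
  shows "q_hat L q (A (coherent \<A> L h \<mu> q)) = (\<Sum>b\<in>H.onb. cnj (q_hat L q b) * q_hat L q (A b))"
proof -
  let ?e = "coherent \<A> L h \<mu> q"
  have "q_hat L q (A ?e) = (\<Sum>b\<in>H.onb. \<langle>b, ?e\<rangle> * q_hat L q (A b))"
    using A by (intro H.functional_expand coherent_reproduces(1)[OF q])
      (simp_all add: endo_def q_hat_add[OF q] q_hat_scale[OF q])
  also have "\<dots> = (\<Sum>b\<in>H.onb. cnj (q_hat L q b) * q_hat L q (A b))"
    using H.ip_cnj[OF coherent_reproduces(1)[OF q] H.onb_in_V] coherent_reproduces(2)[OF q] H.onb_in_V by simp
  finally show ?thesis .
qed

lemma epsilon_eq: "of_real (epsilon \<A> L h \<mu> x) = (\<Sum>b\<in>H.onb. h x (b x) (b x))"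
proof -
  let ?q = "point_over L x" let ?e = "coherent \<A> L h \<mu> ?q"
  have "of_real (Re \<langle>?e, ?e\<rangle>) = (\<Sum>b\<in>H.onb. cnj (q_hat L ?q b) * q_hat L ?q b)"
    using H.ip_real[OF coherent_reproduces(1)[OF point_over(1)]] coherent_reproduces(2)[OF point_over(1)]
      coherent_reproduces(1)[OF point_over(1)] functional_coherent[OF point_over(1), of "\<lambda>s. s"]
    by (simp add: endo_def)
  then show ?thesis
    unfolding epsilon_def Let_def of_real_mult
    by (simp add: sum_distrib_left h_q_hat H.onb_in_V)
qed

lemma epsilon_pos: "epsilon \<A> L h \<mu> x > 0"
proof -
  let ?q = "point_over L x" let ?e = "coherent \<A> L h \<mu> ?q"
  have "Re (h x (snd ?q) (snd ?q)) > 0"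
    using point_over[of x] by (intro h_pos) (auto simp: punctured_def)
  moreover have "Re \<langle>?e, ?e\<rangle> > 0"
    using coherent_nonzero[OF point_over(1), of x] coherent_reproduces(1)[OF point_over(1), of x] H.ip_zero[of ?e]
    by (intro H.ip_pos) auto
  ultimately show ?thesis unfolding epsilon_def Let_def by simp
qed

lemma covariant_symbol_eq:
  assumes A: "A \<in> endo (sec_scl L) \<H>"
  shows "covariant_symbol \<A> L h \<mu> A x = \<langle>coherent \<A> L h \<mu> (point_over L x), A (coherent \<A> L h \<mu> (point_over L x))\<rangle>
      / \<langle>coherent \<A> L h \<mu> (point_over L x), coherent \<A> L h \<mu> (point_over L x)\<rangle>"
proof -
  define e where "e = coherent \<A> L h \<mu> (point_over L x)"
  have eV: "e \<in> \<H>" unfolding e_def by (rule coherent_reproduces(1)[OF point_over(1)])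
  have AV: "A s \<in> \<H>" if "s \<in> \<H>" for s using A that by (simp add: endo_def)
  have P: "coherent_proj \<A> L h \<mu> x = (\<lambda>s. sec_scl L (\<langle>e, s\<rangle> / \<langle>e, e\<rangle>) e)"
    unfolding coherent_proj_def Let_def e_def by (rule refl)
  have AP: "(A \<circ> coherent_proj \<A> L h \<mu> x) s = sec_scl L (\<langle>e, s\<rangle> / \<langle>e, e\<rangle>) (A e)" for s
    using A eV unfolding P by (simp add: endo_def)
  have "A \<circ> coherent_proj \<A> L h \<mu> x \<in> endo (sec_scl L) \<H>"
    unfolding endo_def mem_Collect_eq AP
    using eV AV H.V_intros(3)
    by (simp add: H.ip_add H.ip_scale add_divide_distrib S.scale_left_distrib)
  then have "covariant_symbol \<A> L h \<mu> A x = (\<Sum>b\<in>H.onb. \<langle>b, sec_scl L (\<langle>e, b\<rangle> / \<langle>e, e\<rangle>) (A e)\<rangle>)"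
    unfolding covariant_symbol_def by (simp only: H.trace_eq AP)
  also have "\<dots> = (\<Sum>b\<in>H.onb. \<langle>e, b\<rangle> * \<langle>b, A e\<rangle>) / \<langle>e, e\<rangle>"
    using AV eV by (simp add: H.ip_scale H.onb_in_V sum_divide_distrib)
  also have "\<dots> = \<langle>e, A e\<rangle> / \<langle>e, e\<rangle>"
    using H.parseval[OF eV AV[OF eV]] by simp
  finally show ?thesis unfolding e_def .
qed

text \<open>The identity behind the adjunction. The factor \<open>\<langle>e\<^sub>q, e\<^sub>q\<rangle>\<close> of \<open>\<epsilon>\<close> cancels the denominator of the
  symbol; what remains is \<open>|q|\<^sup>2 q_hat (A e\<^sub>q)\<close>, which is expanded in the orthonormal basis.\<close>

lemma epsilon_symbol_eq:
  assumes A: "A \<in> endo (sec_scl L) \<H>"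
  shows "of_real (epsilon \<A> L h \<mu> x) * covariant_symbol \<A> L h \<mu> A x = (\<Sum>b\<in>H.onb. h x (b x) (A b x))"
proof -
  let ?q = "point_over L x" let ?e = "coherent \<A> L h \<mu> ?q"
  have e: "?e \<in> \<H>" by (rule coherent_reproduces(1)[OF point_over(1)])
  have AV: "A s \<in> \<H>" if "s \<in> \<H>" for s using A that by (simp add: endo_def)
  have "of_real (epsilon \<A> L h \<mu> x) * covariant_symbol \<A> L h \<mu> A x
      = of_real (Re (h x (snd ?q) (snd ?q))) * \<langle>?e, A ?e\<rangle>"
    unfolding covariant_symbol_eq[OF A] epsilon_def Let_def of_real_mult H.ip_real[OF e, symmetric]
    using coherent_nonzero[OF point_over(1), of x] by simp
  also have "\<langle>?e, A ?e\<rangle> = (\<Sum>b\<in>H.onb. cnj (q_hat L ?q b) * q_hat L ?q (A b))"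
    using coherent_reproduces(2)[OF point_over(1) AV[OF e]] functional_coherent[OF point_over(1) A] by simp
  finally show ?thesis
    by (simp add: sum_distrib_left h_q_hat H.onb_in_V AV)
qed

section \<open>Toeplitz operators and the adjunction\<close>

text \<open>The projection is tested only against holomorphic sections, on which \<open>T\<^sub>f s\<close> and \<open>f s\<close> have the
  same scalar products. Existence of the projection is the Riesz theorem for the functional
  \<open>u \<mapsto> \<langle>f s, u\<rangle>\<close>.\<close>

lemma toeplitz_weak:
  assumes f: "continuous_on UNIV f" and s: "s \<in> \<H>"
  shows "toeplitz \<A> L h \<mu> f s \<in> \<H>"
    and "u \<in> \<H> \<Longrightarrow> \<langle>u, toeplitz \<A> L h \<mu> f s\<rangle> = \<langle>u, fun_scl L f s\<rangle>"
proof -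
  let ?fs = "fun_scl L f s"
  have fs: "?fs \<in> continuous_sections"
    by (rule continuous_sections_fun_scl[OF hol_continuous[OF s] f])
  have "set_borel_measurable borel U (\<lambda>x. quot L (e x) (?fs x))" if F: "(U, e) \<in> frames L" for U e
    unfolding set_borel_measurable_def
    using fs F frame(1)[OF F]
    by (intro borel_measurable_continuous_on_indicator) (auto simp: continuous_sections_def)
  then have L2: "?fs \<in> L2_sections L h \<mu>"
    using fs continuous_integrable[OF continuous_h[OF fs fs]]
    by (auto simp: L2_sections_def continuous_sections_def)
  \<comment> \<open>The orthogonality condition of the projection, put into the form to which the Riesz theorem applies.\<close>
  have iff: "t \<in> \<H> \<and> (\<forall>u\<in>\<H>. \<langle>u, ?fs - t\<rangle> = 0) \<longleftrightarrow> t \<in> \<H> \<and> (\<forall>u\<in>\<H>. \<langle>t, u\<rangle> = \<langle>?fs, u\<rangle>)" for t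
  proof (rule conj_cong[OF refl], rule ball_cong[OF refl])
    fix u assume t: "t \<in> \<H>" and u: "u \<in> \<H>"
    have "\<langle>u, ?fs\<rangle> = \<langle>u, ?fs - t\<rangle> + \<langle>u, t\<rangle>"
      using sprod_add[OF hol_continuous[OF u] continuous_sections_diff[OF fs hol_continuous[OF t]] hol_continuous[OF t]]
      by simp
    then show "\<langle>u, ?fs - t\<rangle> = 0 \<longleftrightarrow> \<langle>t, u\<rangle> = \<langle>?fs, u\<rangle>"
      using sprod_cnj[OF hol_continuous[OF u] fs] sprod_cnj[OF hol_continuous[OF u] hol_continuous[OF t]]
      by (metis add_0 add_cancel_left_left complex_cnj_cancel_iff)
  qed
  have ex1: "\<exists>!t. t \<in> \<H> \<and> (\<forall>u\<in>\<H>. \<langle>t, u\<rangle> = \<langle>?fs, u\<rangle>)"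
    by (intro H.riesz sprod_add sprod_scale fs hol_continuous)
  have T: "toeplitz \<A> L h \<mu> f s = (THE t. t \<in> \<H> \<and> (\<forall>u\<in>\<H>. \<langle>t, u\<rangle> = \<langle>?fs, u\<rangle>))"
    using L2 by (simp only: toeplitz_def hol_proj_def if_True iff)
  show TV: "toeplitz \<A> L h \<mu> f s \<in> \<H>" using theI'[OF ex1] unfolding T by blast
  show "\<langle>u, toeplitz \<A> L h \<mu> f s\<rangle> = \<langle>u, ?fs\<rangle>" if u: "u \<in> \<H>"
  proof -
    have "\<langle>toeplitz \<A> L h \<mu> f s, u\<rangle> = \<langle>?fs, u\<rangle>" using theI'[OF ex1] u unfolding T by blast
    then show ?thesis
      using sprod_cnj[OF fs hol_continuous[OF u]] H.ip_cnj[OF TV u] by simp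
  qed
qed

lemma toeplitz_endo:
  assumes f: "continuous_on UNIV f"
  shows "toeplitz \<A> L h \<mu> f \<in> endo (sec_scl L) \<H>"
proof -
  note c = hol_continuous continuous_sections_fun_scl[OF _ f]
  have "toeplitz \<A> L h \<mu> f (s + t) = toeplitz \<A> L h \<mu> f s + toeplitz \<A> L h \<mu> f t"
    if "s \<in> \<H>" "t \<in> \<H>" for s t
  proof (rule H.ip_eqI)
    fix u assume u: "u \<in> \<H>"
    have "fun_scl L f (s + t) = fun_scl L f s + fun_scl L f t"
      by (auto simp: fun_scl_def V.scale_right_distrib)
    then show "\<langle>u, toeplitz \<A> L h \<mu> f (s + t)\<rangle> = \<langle>u, toeplitz \<A> L h \<mu> f s + toeplitz \<A> L h \<mu> f t\<rangle>"
      using that u by (simp add: toeplitz_weak[OF f] H.ip_add H.V_intros sprod_add c)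
  qed (use that in \<open>auto intro!: toeplitz_weak(1)[OF f] H.V_intros\<close>)
  moreover have "toeplitz \<A> L h \<mu> f (sec_scl L a s) = sec_scl L a (toeplitz \<A> L h \<mu> f s)"
    if "s \<in> \<H>" for a s
  proof (rule H.ip_eqI)
    fix u assume u: "u \<in> \<H>"
    have "fun_scl L f (sec_scl L a s) = sec_scl L a (fun_scl L f s)"
      by (auto simp: fun_scl_def V.scale_left_commute)
    then show "\<langle>u, toeplitz \<A> L h \<mu> f (sec_scl L a s)\<rangle> = \<langle>u, sec_scl L a (toeplitz \<A> L h \<mu> f s)\<rangle>"
      using that u by (simp add: toeplitz_weak[OF f] H.ip_scale H.V_intros sprod_scale c)
  qed (use that in \<open>auto intro!: toeplitz_weak(1)[OF f] H.V_intros\<close>)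
  ultimately show ?thesis using toeplitz_weak(1)[OF f] by (simp add: endo_def)
qed

lemma adjoint_op_weak:
  assumes A: "A \<in> endo (sec_scl L) \<H>" and s: "s \<in> \<H>"
  shows "adjoint_op \<A> L h \<mu> A s \<in> \<H>"
    and "u \<in> \<H> \<Longrightarrow> \<langle>u, adjoint_op \<A> L h \<mu> A s\<rangle> = \<langle>A u, s\<rangle>"
proof -
  have AV: "A s \<in> \<H>" if "s \<in> \<H>" for s using A that by (simp add: endo_def)
  have ex1: "\<exists>!t. t \<in> \<H> \<and> (\<forall>u\<in>\<H>. \<langle>t, u\<rangle> = \<langle>s, A u\<rangle>)"
  proof (rule H.riesz)
    show "\<langle>s, A (t + u)\<rangle> = \<langle>s, A t\<rangle> + \<langle>s, A u\<rangle>" if "t \<in> \<H>" "u \<in> \<H>" for t u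
      using A H.ip_add[OF s AV[OF that(1)] AV[OF that(2)]] that by (simp add: endo_def)
    show "\<langle>s, A (sec_scl L a t)\<rangle> = a * \<langle>s, A t\<rangle>" if "t \<in> \<H>" for a t
      using A H.ip_scale[OF s AV[OF that], of a] that by (simp add: endo_def)
  qed
  show V: "adjoint_op \<A> L h \<mu> A s \<in> \<H>"
    using theI'[OF ex1] unfolding adjoint_op_def by blast
  show "\<langle>u, adjoint_op \<A> L h \<mu> A s\<rangle> = \<langle>A u, s\<rangle>" if u: "u \<in> \<H>"
  proof -
    have "\<langle>adjoint_op \<A> L h \<mu> A s, u\<rangle> = \<langle>s, A u\<rangle>"
      using theI'[OF ex1] u unfolding adjoint_op_def by blast
    then show ?thesis using H.ip_cnj[OF V u] H.ip_cnj[OF s AV[OF u]] by simp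
  qed
qed

lemma adjoint_comp_endo:
  assumes A: "A \<in> endo (sec_scl L) \<H>" and C: "C \<in> endo (sec_scl L) \<H>"
  shows "adjoint_op \<A> L h \<mu> A \<circ> C \<in> endo (sec_scl L) \<H>"
proof -
  have AV: "A s \<in> \<H>" if "s \<in> \<H>" for s using A that by (simp add: endo_def)
  have CV: "C s \<in> \<H>" if "s \<in> \<H>" for s using C that by (simp add: endo_def)
  have "adjoint_op \<A> L h \<mu> A (s + t) = adjoint_op \<A> L h \<mu> A s + adjoint_op \<A> L h \<mu> A t"
    if "s \<in> \<H>" "t \<in> \<H>" for s t
    using that by (intro H.ip_eqI) (simp_all add: adjoint_op_weak[OF A] H.ip_add H.V_intros AV)
  moreover have "adjoint_op \<A> L h \<mu> A (sec_scl L a s) = sec_scl L a (adjoint_op \<A> L h \<mu> A s)"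
    if "s \<in> \<H>" for a s
    using that by (intro H.ip_eqI) (simp_all add: adjoint_op_weak[OF A] H.ip_scale H.V_intros AV)
  ultimately show ?thesis
    using C CV adjoint_op_weak(1)[OF A] by (simp add: endo_def)
qed

text \<open>Both sides are brought to the integral of \<open>f\<close> against
  \<open>\<Sum>\<^sub>b h(A b, b)\<close>, the left one by the trace formula and the right one by the expansion of
  \<open>\<epsilon> \<sigma>(A)\<close>.\<close>

theorem toeplitz_symbol_adjoint:
  assumes A: "A \<in> endo (sec_scl L) \<H>" and f: "continuous_on UNIV f"
  shows "hs_prod \<A> L h \<mu> A (toeplitz \<A> L h \<mu> f) = eps_prod \<A> L h \<mu> (covariant_symbol \<A> L h \<mu> A) f"
proof -
  let ?T = "toeplitz \<A> L h \<mu> f" and ?\<sigma> = "covariant_symbol \<A> L h \<mu> A" and ?\<epsilon> = "epsilon \<A> L h \<mu>"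
  have AV: "A s \<in> \<H>" if "s \<in> \<H>" for s using A that by (simp add: endo_def)
  have cont: "b \<in> continuous_sections" "A b \<in> continuous_sections" if "b \<in> H.onb" for b
    using that hol_continuous H.onb_in_V AV by auto
  have "hs_prod \<A> L h \<mu> A ?T = (\<Sum>b\<in>H.onb. \<langle>b, adjoint_op \<A> L h \<mu> A (?T b)\<rangle>)"
    unfolding hs_prod_def
    by (simp add: H.trace_eq[OF adjoint_comp_endo[OF A toeplitz_endo[OF f]]])
  also have "\<dots> = (\<Sum>b\<in>H.onb. \<langle>A b, fun_scl L f b\<rangle>)"
    by (intro sum.cong refl) (simp add: adjoint_op_weak[OF A] toeplitz_weak[OF f] H.onb_in_V AV)
  also have "\<dots> = (\<Sum>b\<in>H.onb. \<integral>x. f x * h x (A b x) (b x) \<partial>\<mu>)"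
  proof (rule sum.cong[OF refl])
    fix b assume b: "b \<in> H.onb"
    show "\<langle>A b, fun_scl L f b\<rangle> = (\<integral>x. f x * h x (A b x) (b x) \<partial>\<mu>)"
      using cont[OF b] by (simp add: sprod_def fun_scl_def h_scale continuous_in_fibre)
  qed
  also have "\<dots> = (\<integral>x. (\<Sum>b\<in>H.onb. f x * h x (A b x) (b x)) \<partial>\<mu>)"
    by (intro Bochner_Integration.integral_sum[symmetric] continuous_integrable continuous_intros continuous_h cont f)
  also have "\<dots> = (\<integral>x. ?\<epsilon> x *\<^sub>R (cnj (?\<sigma> x) * f x) \<partial>\<mu>)"
  proof (intro Bochner_Integration.integral_cong refl)
    fix x
    have "(\<Sum>b\<in>H.onb. h x (A b x) (b x)) = cnj (\<Sum>b\<in>H.onb. h x (b x) (A b x))"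
      unfolding cnj_sum by (intro sum.cong refl h_cnj continuous_in_fibre cont)
    also have "\<dots> = of_real (?\<epsilon> x) * cnj (?\<sigma> x)"
      by (simp flip: epsilon_symbol_eq[OF A])
    finally show "(\<Sum>b\<in>H.onb. f x * h x (A b x) (b x)) = ?\<epsilon> x *\<^sub>R (cnj (?\<sigma> x) * f x)"
      by (simp add: scaleR_conv_of_real mult_ac flip: sum_distrib_left)
  qed
  also have "\<dots> = eps_prod \<A> L h \<mu> ?\<sigma> f"
  proof -
    have "?\<epsilon> = (\<lambda>x. Re (\<Sum>b\<in>H.onb. h x (b x) (b x)))" by (simp flip: epsilon_eq)
    then have eps: "?\<epsilon> \<in> borel_measurable \<mu>"
      by (simp only:) (intro continuous_measurable continuous_intros continuous_h cont)
    \<comment> \<open>The symbol is a quotient of continuous functions with nonvanishing denominator \<open>\<epsilon>\<close>.\<close>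
    have "?\<sigma> x = (\<Sum>b\<in>H.onb. h x (b x) (A b x)) / of_real (?\<epsilon> x)" for x
      using epsilon_pos[of x] by (simp flip: epsilon_symbol_eq[OF A])
    then have "?\<sigma> = (\<lambda>x. (\<Sum>b\<in>H.onb. h x (b x) (A b x)) / of_real (?\<epsilon> x))" by blast
    moreover have "(\<lambda>x. (\<Sum>b\<in>H.onb. h x (b x) (A b x)) / of_real (?\<epsilon> x)) \<in> borel_measurable \<mu>"
      using eps by (intro borel_measurable_divide borel_measurable_sum continuous_measurable[OF continuous_h] cont) auto
    ultimately have "?\<sigma> \<in> borel_measurable \<mu>" by simp
    moreover have "cnj \<in> borel_measurable borel"
      by (intro borel_measurable_continuous_onI continuous_intros)
    ultimately have "(\<lambda>x. cnj (?\<sigma> x)) \<in> borel_measurable \<mu>" by (rule measurable_compose)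
    moreover have "f \<in> borel_measurable \<mu>" by (rule continuous_measurable[OF f])
    ultimately have "(\<lambda>x. cnj (?\<sigma> x) * f x) \<in> borel_measurable \<mu>" by (rule borel_measurable_times)
    then show ?thesis
      unfolding eps_prod_def eps_measure_def using eps epsilon_pos
      by (intro integral_density[symmetric]) (auto simp: less_imp_le)
  qed
  finally show ?thesis .
qed

end

theorem theorem3p1:
  fixes \<A> :: "('m::t2_space, 'n::finite) chart set"
    and \<omega> :: "('m, 'n) form2"
    and L :: "('m, 'v::ab_group_add) line_bundle"
    and h :: "'m \<Rightarrow> 'v \<Rightarrow> 'v \<Rightarrow> complex"
    and nabla :: "('m, 'n) vfield \<Rightarrow> ('m \<Rightarrow> 'v) \<Rightarrow> 'm \<Rightarrow> 'v"
    and \<Omega> :: "'m measure"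
  assumes "compact_kaehler_manifold \<A> \<omega>"
    and "quantum_line_bundle \<A> \<omega> L h nabla"
    and "very_ample \<A> L"
    and "volume_measure \<A> \<omega> \<Omega>"
  shows "\<forall>A \<in> endo (sec_scl L) (hol_sections \<A> L). \<forall>f :: 'm \<Rightarrow> complex. smooth_fun_on \<A> UNIV f \<longrightarrow>
           hs_prod \<A> L h \<Omega> A (toeplitz \<A> L h \<Omega> f) =
           eps_prod \<A> L h \<Omega> (covariant_symbol \<A> L h \<Omega> A) f"
proof (intro ballI allI impI)
  interpret quantised_manifold \<A> \<omega> L h \<Omega>
    using assms by unfold_locales (simp_all add: quantum_line_bundle_def)
  fix A and f :: "'m \<Rightarrow> complex"
  assume "A \<in> endo (sec_scl L) (hol_sections \<A> L)" "smooth_fun_on \<A> UNIV f"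
  then show "hs_prod \<A> L h \<Omega> A (toeplitz \<A> L h \<Omega> f) =
      eps_prod \<A> L h \<Omega> (covariant_symbol \<A> L h \<Omega> A) f"
    by (intro toeplitz_symbol_adjoint smooth_fun_on_imp_continuous_on[OF atlas open_UNIV])
qed

end
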